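(* Let $\nu\in\mathbb{N}$, let $\omega\in\mathbb{R}^{\nu}_{>0}$ be non-resonant, let $\Lambda=\omega\cdot\mathbb{Z}^{\nu}=\{n\cdot\omega: n\in\mathbb{Z}^\nu\}\subseteq\mathbb{R}$ and $b=\nu-1$. Then the following estimates hold for all $T\in(0,1]$ and all $u_0$ with $\sigma(u_0)\subseteq\Lambda$, with implicit constants independent of $T$, $u_0$, $N$, $C$. (i) For every $s>\frac{b}{4}$, $$\| e^{it\partial_x^2}u_0\|_{L^4_t([0,T],\mathcal{L}^4_x(\mathbb{R}))}\lesssim T^{\frac18}\|u_0\|_{\mathcal{H}^s_\Lambda}.$$ (ii) For all dyadic $N,C\in 2^{\mathbb{N}_0}$ with $1\le N\lesssim C$, $$\| e^{t\partial_x^3}P_NR_Cu_0\|_{L^4_t([0,T],\mathcal{L}^4_x(\mathbb{R}))}\lesssim T^{\frac14}\,\langle T^{-\frac12}N^{-\frac12}\rangle^{\frac14}\,C^{\frac b4}\,\|u_0\|_{\mathcal{L}^2_x}.$$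
   Context: Non-resonant means that $\omega_1,\dots,\omega_\nu$ are linearly independent over $\mathbb{Q}$. For $n\in\mathbb{Z}^\nu$ write $\langle n\rangle_\omega=n\cdot\omega$; $|n|$ is the height of the frequency $\langle n\rangle_\omega$. For a real number or vector $A$, $\langle A\rangle=1+|A|$. For $1\le p<\infty$, $\|f\|^p_{\mathcal{L}^p_x(\mathbb{R})}=\lim_{L\to\infty}\frac1{2L}\int_{[-L,L]}|f(x)|^pdx$. $\mathcal{B}_2(\mathbb{R})$ is the closure of the trigonometric polynomials (finite sums $\sum a_\lambda e^{i\lambda x}$, $\lambda\in\mathbb{R}$) under $\|\cdot\|_{\mathcal{L}^2_x}$ (functions at distance $0$ are identified). For $f\in\mathcal{B}_2(\mathbb{R})$, $\hat f(\lambda)=\lim_{L\to\infty}\frac1{2L}\int_{-L}^{L}f(x)e^{-i\lambda x}dx$ and $\sigma(f)=\{\lambda:\hat f(\lambda)\ne0\}$. If $\sigma(f)\subseteq\Lambda$ then $f=\sum_{n\in\mathbb{Z}^\nu}\hat f(\langle n\rangle_\omega)e^{i\langle n\rangle_\omega x}$ in $\mathcal{L}^2_x$, and $\|f\|^2_{\mathcal{H}^s_\Lambda}=\sum_{n\in\mathbb{Z}^\nu}\langle n\rangle^{2s}|\hat f(\langle n\rangle_\omega)|^2$. Propagators: $e^{it\partial_x^2}f=\sum_\lambda \hat f(\lambda)e^{i(\lambda x-t\lambda^2)}$ and $e^{t\partial_x^3}f=\sum_\lambda\hat f(\lambda)e^{i(\lambda x-t\lambda^3)}$. Projections: let $\chi_1\in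 C_c^\infty(-2,2)$ be a fixed radially decreasing function with $\chi_1(\xi)=1$ for $|\xi|\le1$ and, for dyadic $A\in2^{\mathbb{N}}$, $\chi_A(\xi)=\chi_1(|\xi|/A)-\chi_1(2|\xi|/A)$. Then $R_Cf=\sum_n\chi_C(|n|)\hat f(\langle n\rangle_\omega)e^{i\langle n\rangle_\omega x}$ (height localization) and $P_Nf=\sum_n\chi_N(|\langle n\rangle_\omega|)\hat f(\langle n\rangle_\omega)e^{i\langle n\rangle_\omega x}$ (frequency localization). $\|F\|^4_{L^4_t([0,T],\mathcal{L}^4_x)}=\int_0^T\|F(t)\|^4_{\mathcal{L}^4_x}dt$. Estimates for $\mathcal{L}^4_x$-norms are understood as a priori estimates: they hold for all trigonometric polynomials $u_0$ with $\sigma(u_0)\subseteq\Lambda$, with a constant independent of $u_0$, and extend to general $u_0$ by density. Implicit constants may depend on $\omega$, $\nu$, $s$, the cutoff functions and the constant in $N\lesssim C$. *)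

theory Defs
  imports "HOL-Analysis.Analysis"
begin

text \<open>Besicovitch norms. Functions are not quotiented by the relation of being at distance 0;
  every notion below that is applied to a general element of \<open>besicovitch2\<close> (Fourier-Bohr
  coefficients, spectrum, \<open>\<L>\<^sup>2\<close> norm) only depends on its class.\<close>

definition lp_mean :: "real \<Rightarrow> (real \<Rightarrow> complex) \<Rightarrow> real \<Rightarrow> real" where
  "lp_mean p f L = (LINT x:{-L..L}|lebesgue. cmod (f x) powr p) / (2 * L)"

definition besicovitch_norm :: "real \<Rightarrow> (real \<Rightarrow> complex) \<Rightarrow> real" where
  "besicovitch_norm p f = (Lim at_top (lp_mean p f)) powr (1 / p)"

definition trig_poly :: "(real \<Rightarrow> complex) \<Rightarrow> bool" where
  "trig_poly f \<longleftrightarrow>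
     (\<exists>S a. finite S \<and> f = (\<lambda>x. \<Sum>\<xi>\<in>S. a \<xi> * exp (\<i> * complex_of_real (\<xi> * x))))"

definition besicovitch2 :: "(real \<Rightarrow> complex) set" where
  "besicovitch2 = {f. f \<in> borel_measurable lebesgue
     \<and> (\<forall>L. set_integrable lebesgue {-L..L} (\<lambda>x. (cmod (f x))\<^sup>2))
     \<and> (\<forall>\<epsilon>>0. \<exists>p. trig_poly p
           \<and> (\<exists>l. (lp_mean 2 (\<lambda>x. f x - p x) \<longlongrightarrow> l) at_top)
           \<and> besicovitch_norm 2 (\<lambda>x. f x - p x) < \<epsilon>)}"

definition bohr_coeff :: "(real \<Rightarrow> complex) \<Rightarrow> real \<Rightarrow> complex" where
  "bohr_coeff f \<xi> = Lim at_top (\<lambda>L.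
     (LINT x:{-L..L}|lebesgue. f x * exp (- \<i> * complex_of_real (\<xi> * x))) / complex_of_real (2 * L))"

definition spectrum :: "(real \<Rightarrow> complex) \<Rightarrow> real set" where
  "spectrum f = {\<xi>. bohr_coeff f \<xi> \<noteq> 0}"


text \<open>The dimension \<open>\<nu>\<close> is \<open>CARD('n)\<close>, and the lattice is the type \<open>int ^ 'n\<close>.\<close>

definition lattice_vec :: "int ^ 'n \<Rightarrow> real ^ 'n" where
  "lattice_vec n = (\<chi> i. real_of_int (n $ i))"

definition freq :: "real ^ 'n \<Rightarrow> int ^ 'n \<Rightarrow> real" where
  "freq \<omega> n = lattice_vec n \<bullet> \<omega>"

definition freq_module :: "real ^ 'n \<Rightarrow> real set" where
  "freq_module \<omega> = range (freq \<omega>)"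

definition nonresonant :: "real ^ 'n \<Rightarrow> bool" where
  "nonresonant \<omega> \<longleftrightarrow> (\<forall>q :: 'n \<Rightarrow> rat. (\<Sum>i\<in>UNIV. of_rat (q i) * \<omega> $ i) = 0 \<longrightarrow> (\<forall>i. q i = 0))"

definition jbracket :: "'a::real_normed_vector \<Rightarrow> real" where
  "jbracket x = 1 + norm x"

definition sobolev_term :: "real ^ 'n \<Rightarrow> real \<Rightarrow> (real \<Rightarrow> complex) \<Rightarrow> int ^ 'n \<Rightarrow> real" where
  "sobolev_term \<omega> s f n =
     jbracket (lattice_vec n) powr (2 * s) * (cmod (bohr_coeff f (freq \<omega> n)))\<^sup>2"

definition sobolev_norm :: "real ^ 'n \<Rightarrow> real \<Rightarrow> (real \<Rightarrow> complex) \<Rightarrow> real" where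
  "sobolev_norm \<omega> s f = sqrt (\<Sum>\<^sub>\<infinity>n. sobolev_term \<omega> s f n)"


text \<open>Propagators of functions with finite spectrum; for infinite spectrum the sum over
  \<open>spectrum f\<close> is the meaningless value 0, so the general case goes through
  \<open>fourier_partial\<close>.\<close>

definition schroedinger :: "real \<Rightarrow> (real \<Rightarrow> complex) \<Rightarrow> real \<Rightarrow> complex" where
  "schroedinger t f = (\<lambda>x. \<Sum>\<xi>\<in>spectrum f.
     bohr_coeff f \<xi> * exp (\<i> * complex_of_real (\<xi> * x - t * \<xi>\<^sup>2)))"

definition airy :: "real \<Rightarrow> (real \<Rightarrow> complex) \<Rightarrow> real \<Rightarrow> complex" where
  "airy t f = (\<lambda>x. \<Sum>\<xi>\<in>spectrum f.
     bohr_coeff f \<xi> * exp (\<i> * complex_of_real (\<xi> * x - t * \<xi> ^ 3)))"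

definition fourier_partial ::
  "real ^ 'n \<Rightarrow> (int ^ 'n) set \<Rightarrow> (real \<Rightarrow> complex) \<Rightarrow> real \<Rightarrow> complex" where
  "fourier_partial \<omega> S f = (\<lambda>x. \<Sum>n\<in>S.
     bohr_coeff f (freq \<omega> n) * exp (\<i> * complex_of_real (freq \<omega> n * x)))"


definition dyadic :: "real set" where
  "dyadic = range (\<lambda>k::nat. 2 ^ k)"

definition cutoff :: "(real \<Rightarrow> real) \<Rightarrow> bool" where
  "cutoff \<theta> \<longleftrightarrow> (\<forall>k. (deriv ^^ k) \<theta> differentiable_on UNIV)
     \<and> compact (closure {\<xi>. \<theta> \<xi> \<noteq> 0}) \<and> closure {\<xi>. \<theta> \<xi> \<noteq> 0} \<subseteq> {-2<..<2}
     \<and> (\<forall>\<xi> \<eta>. \<bar>\<xi>\<bar> \<le> \<bar>\<eta>\<bar> \<longrightarrow> \<theta> \<eta> \<le> \<theta> \<xi>)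
     \<and> (\<forall>\<xi>. \<bar>\<xi>\<bar> \<le> 1 \<longrightarrow> \<theta> \<xi> = 1)"

text \<open>The lowest dyadic block \<open>A = 1\<close> is the given cutoff itself; the difference formula
  is for \<open>A \<ge> 2\<close>.\<close>

definition dyadic_cutoff :: "(real \<Rightarrow> real) \<Rightarrow> real \<Rightarrow> real \<Rightarrow> real" where
  "dyadic_cutoff \<theta> A \<xi> =
     (if A = 1 then \<theta> \<xi> else \<theta> (\<bar>\<xi>\<bar> / A) - \<theta> (2 * \<bar>\<xi>\<bar> / A))"

text \<open>Fourier multiplier on the lattice, meaningful when only finitely many terms are nonzero.
  This holds for \<open>height_proj\<close> on every function (the height is cut off) and for
  \<open>freq_proj\<close> on functions of finite spectrum (if \<open>\<omega>\<close> is nonresonant).\<close>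

definition lattice_multiplier ::
  "real ^ 'n \<Rightarrow> (int ^ 'n \<Rightarrow> real) \<Rightarrow> (real \<Rightarrow> complex) \<Rightarrow> real \<Rightarrow> complex" where
  "lattice_multiplier \<omega> m f = (\<lambda>x. \<Sum>n | complex_of_real (m n) * bohr_coeff f (freq \<omega> n) \<noteq> 0.
     complex_of_real (m n) * bohr_coeff f (freq \<omega> n) * exp (\<i> * complex_of_real (freq \<omega> n * x)))"

definition height_proj ::
  "(real \<Rightarrow> real) \<Rightarrow> real ^ 'n \<Rightarrow> real \<Rightarrow> (real \<Rightarrow> complex) \<Rightarrow> real \<Rightarrow> complex" where
  "height_proj \<theta> \<omega> C = lattice_multiplier \<omega> (\<lambda>n. dyadic_cutoff \<theta> C (norm (lattice_vec n)))"

definition freq_proj ::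
  "(real \<Rightarrow> real) \<Rightarrow> real ^ 'n \<Rightarrow> real \<Rightarrow> (real \<Rightarrow> complex) \<Rightarrow> real \<Rightarrow> complex" where
  "freq_proj \<theta> \<omega> N = lattice_multiplier \<omega> (\<lambda>n. dyadic_cutoff \<theta> N \<bar>freq \<omega> n\<bar>)"


definition l4l4_norm :: "real \<Rightarrow> (real \<Rightarrow> real \<Rightarrow> complex) \<Rightarrow> real" where
  "l4l4_norm T F = (LINT t:{0..T}|lebesgue. besicovitch_norm 4 (F t) ^ 4) powr (1 / 4)"

end

theory Submission
  imports Defs
begin

text \<open>Both estimates come from one quartic computation. For \<open>F(t, x) = \<Sum> c\<^sub>n e\<^bsup>i(\<mu>\<^sub>n x - t \<phi>\<^sub>n)\<^esup>\<close> the mean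
  of \<open>\<bar>F(t)\<bar>\<^sup>4\<close> is a sum over pairs of pairs \<open>(m, n), (k, l)\<close> with \<open>\<mu>\<^sub>m + \<mu>\<^sub>n = \<mu>\<^sub>k + \<mu>\<^sub>l\<close>, and
  integrating over \<open>[0, T]\<close> weights each quadruple by at most \<open>3T / (1 + T\<bar>\<Delta>\<phi>\<bar>)\<close>. With
  \<open>x = \<mu>\<^sub>m - \<mu>\<^sub>n\<close> and \<open>y = \<mu>\<^sub>k - \<mu>\<^sub>l\<close> the phase difference is \<open>(x\<^sup>2 - y\<^sup>2) / 2\<close> for \<open>\<phi> = \<mu>\<^sup>2\<close> and
  \<open>3/4 (\<mu>\<^sub>m + \<mu>\<^sub>n) (x\<^sup>2 - y\<^sup>2)\<close> for \<open>\<phi> = \<mu>\<^sup>3\<close>, so the kernel is dominated by two Lorentzians in \<open>\<mu>\<^sub>k\<close>.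
  A Schur test reduces the estimate to summing a Lorentzian in \<open>\<mu>\<^sub>k\<close> against a weight in the lattice
  point \<open>k\<close>: freezing all coordinates of \<open>k\<close> but one leaves an arithmetic progression, and the
  other \<open>\<nu> - 1\<close> coordinates are summed with the weight \<open>\<Prod> (1 + \<bar>k\<^sub>i\<bar>)\<^bsup>-p\<^esup>\<close>, \<open>p > 1\<close>, in (i), and with
  the height cutoff in (ii). In the cubic case positive and negative frequencies are treated
  separately, to keep \<open>\<bar>\<mu>\<^sub>m + \<mu>\<^sub>n\<bar> \<ge> N\<close>; the block \<open>N = 1\<close> only needs \<open>\<bar>\<mu>\<^sub>k\<bar> < 2\<close>.\<close>

section \<open>Means\<close>

text \<open>Stated as a relation, since \<open>Lim\<close> denotes a limit only once convergence is
  known. Local integrability is included because a non-integrable function has Bochner integral 0,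
  which would spoil additivity and monotonicity.\<close>

definition has_mean :: "(real \<Rightarrow> 'a::{banach,second_countable_topology}) \<Rightarrow> 'a \<Rightarrow> bool" where
  "has_mean f m \<longleftrightarrow> (\<forall>L. set_integrable lebesgue {-L..L} f)
     \<and> ((\<lambda>L. (LINT x:{-L..L}|lebesgue. f x) /\<^sub>R (2 * L)) \<longlongrightarrow> m) at_top"

lemma has_mean_add:
  assumes "has_mean f a" "has_mean g b"
  shows "has_mean (\<lambda>x. f x + g x) (a + b)"
proof -
  have "((\<lambda>L. (LINT x:{-L..L}|lebesgue. f x) /\<^sub>R (2 * L) + (LINT x:{-L..L}|lebesgue. g x) /\<^sub>R (2 * L)) \<longlongrightarrow> a + b) at_top"
    using assms unfolding has_mean_def by (intro tendsto_add) auto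
  moreover have "(LINT x:{-L..L}|lebesgue. f x + g x) = (LINT x:{-L..L}|lebesgue. f x) + (LINT x:{-L..L}|lebesgue. g x)" for L
    using assms unfolding has_mean_def by (intro set_integral_add) auto
  ultimately show ?thesis
    using assms unfolding has_mean_def by (auto simp: scaleR_add_right intro: set_integral_add(1))
qed

text \<open>Bounded linear maps commute with the Bochner integral and with limits. This covers
  scalar multiples as well as real parts, by which complex exponential sums yield real
  means.\<close>

lemma has_mean_bounded_linear:
  assumes "bounded_linear T" "has_mean f a"
  shows "has_mean (\<lambda>x. T (f x)) (T a)"
proof -
  interpret T: bounded_linear T by fact
  have 1: "set_integrable lebesgue {-L..L} (\<lambda>x. T (f x))"
    and 2: "(LINT x:{-L..L}|lebesgue. T (f x)) = T (LINT x:{-L..L}|lebesgue. f x)" for L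
  proof -
    have i: "integrable lebesgue (\<lambda>x. indicator {-L..L} x *\<^sub>R f x)"
      using assms(2) unfolding has_mean_def set_integrable_def by auto
    show "set_integrable lebesgue {-L..L} (\<lambda>x. T (f x))"
      using integrable_bounded_linear[OF assms(1) i] unfolding set_integrable_def by (simp add: T.scaleR)
    show "(LINT x:{-L..L}|lebesgue. T (f x)) = T (LINT x:{-L..L}|lebesgue. f x)"
      using integral_bounded_linear[OF assms(1) i] unfolding set_lebesgue_integral_def by (simp add: T.scaleR)
  qed
  have "((\<lambda>L. T ((LINT x:{-L..L}|lebesgue. f x) /\<^sub>R (2 * L))) \<longlongrightarrow> T a) at_top"
    using assms unfolding has_mean_def by (intro T.tendsto) auto
  then show ?thesis using 1 2 unfolding has_mean_def by (simp add: T.scaleR)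
qed

lemma has_mean_0: "has_mean (\<lambda>x. 0) 0"
  unfolding has_mean_def set_integrable_def set_lebesgue_integral_def by simp

lemma has_mean_sum:
  assumes "\<And>i. i \<in> S \<Longrightarrow> has_mean (f i) (a i)"
  shows "has_mean (\<lambda>x. \<Sum>i\<in>S. f i x) (\<Sum>i\<in>S. a i)"
  using assms by (induction S rule: infinite_finite_induct) (auto intro: has_mean_0 has_mean_add)

lemma has_mean_cmult:
  fixes c :: "'a::{banach,second_countable_topology,real_normed_algebra}"
  shows "has_mean f a \<Longrightarrow> has_mean (\<lambda>x. c * f x) (c * a)"
  by (rule has_mean_bounded_linear[OF bounded_linear_mult_right])

lemma has_mean_le:
  fixes f g :: "real \<Rightarrow> real"
  assumes "has_mean f a" "has_mean g b" "\<And>x. f x \<le> g x"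
  shows "a \<le> b"
proof (rule tendsto_le[OF _ assms(2)[unfolded has_mean_def, THEN conjunct2] assms(1)[unfolded has_mean_def, THEN conjunct2]])
  show "\<forall>\<^sub>F L in at_top. (LINT x:{-L..L}|lebesgue. f x) /\<^sub>R (2 * L) \<le> (LINT x:{-L..L}|lebesgue. g x) /\<^sub>R (2 * L)"
    using eventually_gt_at_top[of 0]
  proof eventually_elim
    case (elim L)
    have "(LINT x:{-L..L}|lebesgue. f x) \<le> (LINT x:{-L..L}|lebesgue. g x)"
      using assms unfolding has_mean_def by (intro set_integral_mono) auto
    then show ?case using elim by (simp add: divide_right_mono field_simps)
  qed
qed simp

lemma set_integrable_lebesgue_continuous:
  fixes f :: "real \<Rightarrow> 'a::{banach,second_countable_topology}"
  assumes "continuous_on UNIV f"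
  shows "set_integrable lebesgue {a..b} f"
proof -
  have "integrable lborel (\<lambda>x. indicator {a..b} x *\<^sub>R f x)"
    by (intro borel_integrable_compact continuous_on_subset[OF assms]) auto
  then show ?thesis unfolding set_integrable_def by (simp add: integrable_completion)
qed

text \<open>The fundamental theorem of calculus is applied over \<open>lborel\<close>, while means
  are taken over its completion \<open>lebesgue\<close>; a continuous integrand is Borel, so
  completing the measure does not change its integral.\<close>

lemma set_integral_lebesgue_continuous:
  fixes f :: "real \<Rightarrow> 'a::{banach,second_countable_topology}"
  assumes "continuous_on UNIV f"
  shows "(LINT x:{a..b}|lebesgue. f x) = (LBINT x:{a..b}. f x)"
  unfolding set_lebesgue_integral_def
  by (intro integral_completion borel_measurable_integrable borel_integrable_compact continuous_on_subset[OF assms]) auto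

text \<open>The antiderivative has modulus \<open>1 / \<bar>\<xi>\<bar>\<close> at either end, so
  the bound does not grow with the interval. It serves twice: divided by \<open>2 * L\<close> for
  orthogonality in space, and on \<open>{0..T}\<close> for decay in the phase difference.\<close>

lemma norm_integral_exp_le:
  assumes "a \<le> b" "\<xi> \<noteq> 0"
  shows "cmod (LINT x:{a..b}|lebesgue. exp (\<i> * complex_of_real (\<xi> * x))) \<le> 2 / \<bar>\<xi>\<bar>"
proof -
  let ?e = "\<lambda>x. exp (\<i> * complex_of_real (\<xi> * x))"
  let ?F = "\<lambda>x. ?e x / (\<i> * complex_of_real \<xi>)"
  have "(LINT x:{a..b}|lebesgue. ?e x) = (LBINT x:{a..b}. ?e x)"
    by (intro set_integral_lebesgue_continuous continuous_intros)
  also have "\<dots> = ?F b - ?F a"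
    unfolding set_lebesgue_integral_def
  proof (rule integral_FTC_Icc[OF assms(1)])
    fix x assume "a \<le> x" "x \<le> b"
    show "(?F has_vector_derivative ?e x) (at x within {a..b})"
    proof -
      have "((\<lambda>z. exp (\<i> * (complex_of_real \<xi> * z)) / (\<i> * complex_of_real \<xi>)) has_field_derivative
          exp (\<i> * (complex_of_real \<xi> * complex_of_real x))) (at (complex_of_real x))"
        using assms(2) by (auto intro!: derivative_eq_intros simp: algebra_simps)
      from has_vector_derivative_real_field[OF this] show ?thesis by simp
    qed
  qed (intro continuous_intros)
  finally have "cmod (LINT x:{a..b}|lebesgue. ?e x) \<le> cmod (?F b) + cmod (?F a)"
    using norm_triangle_ineq4 by simp
  also have "\<dots> = 2 / \<bar>\<xi>\<bar>" by (simp add: norm_divide norm_mult)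
  finally show ?thesis .
qed

text \<open>Orthogonality of characters; by linearity, the means of exponential sums below reduce to
  it.\<close>

lemma has_mean_exp:
  "has_mean (\<lambda>x. exp (\<i> * complex_of_real (\<xi> * x))) (if \<xi> = 0 then 1 else 0)"
proof -
  let ?e = "\<lambda>x. exp (\<i> * complex_of_real (\<xi> * x))"
  have "((\<lambda>L. (LINT x:{-L..L}|lebesgue. ?e x) /\<^sub>R (2 * L)) \<longlongrightarrow> (if \<xi> = 0 then 1 else 0)) at_top"
  proof (cases "\<xi> = 0")
    case True
    have "\<forall>\<^sub>F L in at_top. (LINT x:{-L..L}|lebesgue. ?e x) /\<^sub>R (2 * L) = 1"
      using eventually_gt_at_top[of 0]
      by eventually_elim (simp add: True set_lebesgue_integral_def scaleR_conv_of_real divide_simps)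
    then show ?thesis using True by (simp add: tendsto_eventually)
  next
    case False
    have "((\<lambda>L. (LINT x:{-L..L}|lebesgue. ?e x) /\<^sub>R (2 * L)) \<longlongrightarrow> 0) at_top"
    proof (rule Lim_null_comparison)
      show "\<forall>\<^sub>F L in at_top. norm ((LINT x:{-L..L}|lebesgue. ?e x) /\<^sub>R (2 * L)) \<le> (1 / \<bar>\<xi>\<bar>) * inverse L"
        using eventually_gt_at_top[of 0]
      proof eventually_elim
        case (elim L)
        have "norm ((LINT x:{-L..L}|lebesgue. ?e x) /\<^sub>R (2 * L))
          = inverse (2 * L) * cmod (LINT x:{-L..L}|lebesgue. ?e x)"
          unfolding norm_scaleR using elim by simp
        also have "\<dots> \<le> inverse (2 * L) * (2 / \<bar>\<xi>\<bar>)"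
          using elim False by (intro mult_left_mono norm_integral_exp_le) auto
        also have "\<dots> = (1 / \<bar>\<xi>\<bar>) * inverse L" using elim False by (simp add: field_simps)
        finally show ?case .
      qed
      show "((\<lambda>L. (1 / \<bar>\<xi>\<bar>) * inverse L) \<longlongrightarrow> 0) at_top"
        by (intro tendsto_mult_right_zero tendsto_inverse_0_at_top filterlim_ident)
    qed
    then show ?thesis using False by simp
  qed
  then show ?thesis unfolding has_mean_def by (auto intro!: set_integrable_lebesgue_continuous continuous_intros)
qed

lemma Lim_lp_mean:
  assumes "has_mean (\<lambda>x. cmod (f x) powr p) m"
  shows "(lp_mean p f \<longlongrightarrow> m) at_top" "Lim at_top (lp_mean p f) = m"
proof -
  show "(lp_mean p f \<longlongrightarrow> m) at_top"
    using assms unfolding has_mean_def lp_mean_def[abs_def] by (simp add: field_simps)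
  then show "Lim at_top (lp_mean p f) = m" by (intro tendsto_Lim) auto
qed

text \<open>Existence of the mean is what gives the \<open>Lim\<close> inside
  \<open>besicovitch_norm\<close> a meaning. Mean 0 is treated apart because the conversion between
  \<open>powr\<close> and natural powers needs a positive base.\<close>

lemma besicovitch_norm_power:
  assumes "has_mean (\<lambda>x. cmod (f x) ^ k) m" "k > 0"
  shows "besicovitch_norm (real k) f ^ k = m" "m \<ge> 0"
proof -
  have *: "cmod (f x) powr real k = cmod (f x) ^ k" for x
    using assms(2) by (cases "cmod (f x) = 0") (auto simp: powr_realpow)
  have "m \<ge> 0" using has_mean_le[OF has_mean_0 assms(1)] by simp
  then show "m \<ge> 0" .
  have "Lim at_top (lp_mean (real k) f) = m" using Lim_lp_mean(2)[of f "real k" m] assms * by simp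
  moreover have "(m powr (1 / real k)) ^ k = m"
  proof (cases "m = 0")
    case False
    then have "(m powr (1 / real k)) ^ k = (m powr (1 / real k)) powr real k" by (simp add: powr_realpow)
    then show ?thesis using assms(2) \<open>m \<ge> 0\<close> by (simp add: powr_powr)
  qed (use assms(2) in simp)
  ultimately show "besicovitch_norm (real k) f ^ k = m" unfolding besicovitch_norm_def by simp
qed

lemma bohr_coeff_eqI:
  assumes "has_mean (\<lambda>x. f x * exp (- \<i> * complex_of_real (\<xi> * x))) m"
  shows "bohr_coeff f \<xi> = m"
  unfolding bohr_coeff_def using assms unfolding has_mean_def
  by (intro tendsto_Lim) (auto simp: scaleR_conv_of_real field_simps)

lemma exp_i_of_real_diff:
  "exp (\<i> * complex_of_real a) * exp (- \<i> * complex_of_real b) = exp (\<i> * complex_of_real (a - b))"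
  by (simp add: exp_add[symmetric] algebra_simps)

text \<open>Multiplying by the conjugate character shifts every frequency by \<open>\<xi>\<close>,
  and orthogonality keeps the terms shifted to 0. Writing the result as a sum over a fibre also
  covers \<open>\<xi>\<close> outside the image of \<open>S\<close>.\<close>

lemma bohr_coeff_exp_sum:
  assumes "finite S" "inj_on \<mu> S"
  shows "bohr_coeff (\<lambda>x. \<Sum>n\<in>S. c n * exp (\<i> * complex_of_real (\<mu> n * x))) \<xi> = (\<Sum>n | n \<in> S \<and> \<mu> n = \<xi>. c n)"
proof (rule bohr_coeff_eqI)
  have "has_mean (\<lambda>x. \<Sum>n\<in>S. c n * exp (\<i> * complex_of_real ((\<mu> n - \<xi>) * x)))
    (\<Sum>n\<in>S. c n * (if \<mu> n - \<xi> = 0 then 1 else 0))"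
    by (intro has_mean_sum has_mean_cmult has_mean_exp)
  also have "(\<lambda>x. \<Sum>n\<in>S. c n * exp (\<i> * complex_of_real ((\<mu> n - \<xi>) * x)))
     = (\<lambda>x. (\<Sum>n\<in>S. c n * exp (\<i> * complex_of_real (\<mu> n * x))) * exp (- \<i> * complex_of_real (\<xi> * x)))"
    unfolding sum_distrib_right mult.assoc exp_i_of_real_diff by (simp add: left_diff_distrib)
  also have "(\<Sum>n\<in>S. c n * (if \<mu> n - \<xi> = 0 then 1 else 0)) = (\<Sum>n | n \<in> S \<and> \<mu> n = \<xi>. c n)"
    using assms(1) by (intro sum.mono_neutral_cong_right) auto
  finally show "has_mean (\<lambda>x. (\<Sum>n\<in>S. c n * exp (\<i> * complex_of_real (\<mu> n * x))) * exp (- \<i> * complex_of_real (\<xi> * x)))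
     (\<Sum>n | n \<in> S \<and> \<mu> n = \<xi>. c n)" .
qed

lemma bohr_coeff_exp_sum_at:
  assumes "finite S" "inj \<mu>"
  shows "bohr_coeff (\<lambda>x. \<Sum>n\<in>S. c n * exp (\<i> * complex_of_real (\<mu> n * x))) (\<mu> m) = (if m \<in> S then c m else 0)"
proof -
  have "{n. n \<in> S \<and> \<mu> n = \<mu> m} = (if m \<in> S then {m} else {})" using assms(2) by (auto dest: injD)
  moreover have "inj_on \<mu> S" using assms(2) by (rule inj_on_subset) simp
  ultimately show ?thesis using bohr_coeff_exp_sum[OF assms(1), of \<mu> c "\<mu> m"] by simp
qed

lemma spectrum_exp_sum:
  assumes "finite S" "inj \<mu>"
  shows "spectrum (\<lambda>x. \<Sum>n\<in>S. c n * exp (\<i> * complex_of_real (\<mu> n * x))) = \<mu> ` {n\<in>S. c n \<noteq> 0}"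
proof -
  let ?f = "\<lambda>x. \<Sum>n\<in>S. c n * exp (\<i> * complex_of_real (\<mu> n * x))"
  have "\<xi> \<in> spectrum ?f \<longleftrightarrow> \<xi> \<in> \<mu> ` {n\<in>S. c n \<noteq> 0}" for \<xi>
  proof (cases "\<xi> \<in> range \<mu>")
    case True
    then obtain m where "\<xi> = \<mu> m" by auto
    then show ?thesis
      using bohr_coeff_exp_sum_at[OF assms, of c m] assms(2)
      unfolding spectrum_def by (auto simp: inj_image_mem_iff)
  next
    case False
    have "inj_on \<mu> S" using assms(2) by (rule inj_on_subset) simp
    then have "bohr_coeff ?f \<xi> = (\<Sum>n | n \<in> S \<and> \<mu> n = \<xi>. c n)" by (rule bohr_coeff_exp_sum[OF assms(1)])
    also have "{n. n \<in> S \<and> \<mu> n = \<xi>} = {}" using False by auto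
    finally show ?thesis using False unfolding spectrum_def by auto
  qed
  then show ?thesis by blast
qed

section \<open>Quartic means of dispersive evolutions\<close>

text \<open>The fourth power is \<open>Z * Z * cnj (Z * Z)\<close>, a sum of exponentials of
  frequency \<open>\<mu> m + \<mu> n - \<mu> k - \<mu> l\<close>; orthogonality keeps the resonant
  quadruples.\<close>

lemma has_mean_exp_sum_power4:
  fixes d :: "'a \<Rightarrow> complex"
  assumes "finite S"
  shows "has_mean (\<lambda>x. cmod (\<Sum>n\<in>S. d n * exp (\<i> * complex_of_real (\<mu> n * x))) ^ 4)
    (Re (\<Sum>(m, n)\<in>S \<times> S. \<Sum>(k, l)\<in>S \<times> S.
       if \<mu> m + \<mu> n = \<mu> k + \<mu> l then d m * d n * cnj (d k * d l) else 0))"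
proof -
  let ?Z = "\<lambda>x. \<Sum>n\<in>S. d n * exp (\<i> * complex_of_real (\<mu> n * x))"
  let ?e = "\<lambda>m n k l x. exp (\<i> * complex_of_real ((\<mu> m + \<mu> n - (\<mu> k + \<mu> l)) * x))"
  have "has_mean (\<lambda>x. Re (\<Sum>p\<in>S \<times> S. \<Sum>q\<in>S \<times> S. d (fst p) * d (snd p) * cnj (d (fst q) * d (snd q)) * ?e (fst p) (snd p) (fst q) (snd q) x))
    (Re (\<Sum>p\<in>S \<times> S. \<Sum>q\<in>S \<times> S. d (fst p) * d (snd p) * cnj (d (fst q) * d (snd q)) *
       (if \<mu> (fst p) + \<mu> (snd p) - (\<mu> (fst q) + \<mu> (snd q)) = 0 then 1 else 0)))"
    by (intro has_mean_bounded_linear[OF bounded_linear_Re] has_mean_sum has_mean_cmult has_mean_exp)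
  also have "(\<Sum>p\<in>S \<times> S. \<Sum>q\<in>S \<times> S. d (fst p) * d (snd p) * cnj (d (fst q) * d (snd q)) *
       (if \<mu> (fst p) + \<mu> (snd p) - (\<mu> (fst q) + \<mu> (snd q)) = 0 then 1 else 0))
     = (\<Sum>(m, n)\<in>S \<times> S. \<Sum>(k, l)\<in>S \<times> S.
       if \<mu> m + \<mu> n = \<mu> k + \<mu> l then d m * d n * cnj (d k * d l) else 0)"
    by (intro sum.cong refl) (auto intro!: sum.cong)
  also have "(\<lambda>x. Re (\<Sum>p\<in>S \<times> S. \<Sum>q\<in>S \<times> S. d (fst p) * d (snd p) * cnj (d (fst q) * d (snd q)) * ?e (fst p) (snd p) (fst q) (snd q) x))
    = (\<lambda>x. cmod (?Z x) ^ 4)"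
  proof
    fix x
    let ?E = "\<lambda>n. exp (\<i> * complex_of_real (\<mu> n * x))"
    have sq: "?Z x * ?Z x = (\<Sum>p\<in>S \<times> S. d (fst p) * ?E (fst p) * (d (snd p) * ?E (snd p)))"
      by (simp add: sum_product sum.cartesian_product case_prod_beta)
    have e: "?e m n k l x = ?E m * ?E n * cnj (?E k * ?E l)" for m n k l
      by (simp add: exp_cnj exp_add[symmetric] algebra_simps)
    have "complex_of_real (cmod (?Z x) ^ 4) = (?Z x * ?Z x) * cnj (?Z x * ?Z x)"
      unfolding complex_norm_square[symmetric] by (simp add: norm_mult power4_eq_xxxx power2_eq_square)
    also have "\<dots> = (\<Sum>p\<in>S \<times> S. \<Sum>q\<in>S \<times> S. d (fst p) * d (snd p) * cnj (d (fst q) * d (snd q)) * ?e (fst p) (snd p) (fst q) (snd q) x)"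
      unfolding sq unfolding cnj_sum sum_product e by (intro sum.cong refl) simp
    finally show "Re (\<Sum>p\<in>S \<times> S. \<Sum>q\<in>S \<times> S. d (fst p) * d (snd p) * cnj (d (fst q) * d (snd q)) * ?e (fst p) (snd p) (fst q) (snd q) x) = cmod (?Z x) ^ 4"
      by (metis Re_complex_of_real)
  qed
  finally show ?thesis .
qed

text \<open>Frequencies and phases are independent functions on an arbitrary index set, so that one
  estimate covers both equations, differences of partial sums, and restrictions to one sign of the
  frequency.\<close>

definition evolution :: "'a set \<Rightarrow> ('a \<Rightarrow> complex) \<Rightarrow> ('a \<Rightarrow> real) \<Rightarrow> ('a \<Rightarrow> real) \<Rightarrow> real \<Rightarrow> real \<Rightarrow> complex" where
  "evolution S c \<mu> \<phi> t x = (\<Sum>n\<in>S. c n * exp (\<i> * complex_of_real (\<mu> n * x - t * \<phi> n)))"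

text \<open>Its real part is the spatial mean of the fourth power at time \<open>t\<close>; the
  complex exponential sum is kept so that time can be integrated term by term.\<close>

definition evolution_quartic :: "'a set \<Rightarrow> ('a \<Rightarrow> complex) \<Rightarrow> ('a \<Rightarrow> real) \<Rightarrow> ('a \<Rightarrow> real) \<Rightarrow> real \<Rightarrow> complex" where
  "evolution_quartic S c \<mu> \<phi> t = (\<Sum>(m, n)\<in>S \<times> S. \<Sum>(k, l)\<in>S \<times> S.
     if \<mu> m + \<mu> n = \<mu> k + \<mu> l
     then c m * c n * cnj (c k * c l) * exp (\<i> * complex_of_real ((\<phi> k + \<phi> l - (\<phi> m + \<phi> n)) * t)) else 0)"

lemma has_mean_evolution_power4:
  assumes "finite S"
  shows "has_mean (\<lambda>x. cmod (evolution S c \<mu> \<phi> t x) ^ 4) (Re (evolution_quartic S c \<mu> \<phi> t))"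
proof -
  \<comment> \<open>At a fixed time the phases are absorbed into the coefficients, which leaves a
    plain exponential sum in \<open>x\<close>.\<close>
  let ?d = "\<lambda>n. c n * exp (- \<i> * complex_of_real (t * \<phi> n))"
  have "evolution S c \<mu> \<phi> t x = (\<Sum>n\<in>S. ?d n * exp (\<i> * complex_of_real (\<mu> n * x)))" for x
    unfolding evolution_def by (intro sum.cong refl) (simp add: exp_add[symmetric] algebra_simps)
  moreover have "evolution_quartic S c \<mu> \<phi> t = (\<Sum>(m, n)\<in>S \<times> S. \<Sum>(k, l)\<in>S \<times> S.
       if \<mu> m + \<mu> n = \<mu> k + \<mu> l then ?d m * ?d n * cnj (?d k * ?d l) else 0)"
    unfolding evolution_quartic_def case_prod_beta
    by (intro sum.cong refl if_cong) (simp add: exp_cnj exp_add[symmetric] algebra_simps)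
  ultimately show ?thesis using has_mean_exp_sum_power4[OF assms, of ?d \<mu>] by simp
qed

lemma continuous_evolution_quartic: "continuous_on A (evolution_quartic S c \<mu> \<phi>)"
  unfolding evolution_quartic_def[abs_def] case_prod_beta
proof (intro continuous_on_sum)
  fix p q :: "'a \<times> 'a"
  show "continuous_on A (\<lambda>t. if \<mu> (fst p) + \<mu> (snd p) = \<mu> (fst q) + \<mu> (snd q)
     then c (fst p) * c (snd p) * cnj (c (fst q) * c (snd q)) *
       exp (\<i> * complex_of_real ((\<phi> (fst q) + \<phi> (snd q) - (\<phi> (fst p) + \<phi> (snd p))) * t)) else 0)"
    by (cases "\<mu> (fst p) + \<mu> (snd p) = \<mu> (fst q) + \<mu> (snd q)") (auto intro!: continuous_intros)
qed

text \<open>With \<open>I\<close> the integral, the trivial bound \<open>cmod I \<le> T\<close> is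
  added to \<open>T\<close> times the oscillation bound
  \<open>cmod I * \<bar>\<xi>\<bar> \<le> 2\<close>; hence the constant 3.\<close>

lemma norm_time_integral_exp_le:
  assumes "0 < T"
  shows "cmod (LINT t:{0..T}|lebesgue. exp (\<i> * complex_of_real (\<xi> * t))) \<le> 3 * T / (1 + T * \<bar>\<xi>\<bar>)"
proof -
  let ?I = "LINT t:{0..T}|lebesgue. exp (\<i> * complex_of_real (\<xi> * t))"
  have "cmod ?I \<le> (LINT t:{0..T}|lebesgue. 1)"
    using set_integral_norm_bound[OF set_integrable_lebesgue_continuous, of "\<lambda>t. exp (\<i> * complex_of_real (\<xi> * t))" 0 T]
    by (simp add: continuous_intros)
  then have 1: "cmod ?I \<le> T" using assms by (simp add: set_lebesgue_integral_def)
  have 2: "cmod ?I * \<bar>\<xi>\<bar> \<le> 2"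
    using norm_integral_exp_le[of 0 T \<xi>] assms by (cases "\<xi> = 0") (auto simp: field_simps)
  have "cmod ?I * (1 + T * \<bar>\<xi>\<bar>) = cmod ?I + T * (cmod ?I * \<bar>\<xi>\<bar>)" by (simp add: algebra_simps)
  also have "\<dots> \<le> T + T * 2" using 1 2 assms by (intro add_mono mult_left_mono) auto
  finally show ?thesis using assms by (simp add: pos_le_divide_eq add_pos_nonneg)
qed

text \<open>Each product \<open>a p * a q\<close> is split by the weighted arithmetic-geometric mean
  inequality; symmetry of \<open>\<kappa>\<close> makes the two halves equal, and \<open>W\<close>
  bounds the inner sum. Since \<open>W\<close> is not scaled by \<open>w p\<close>, the weight
  survives as \<open>1 / w p\<close>.\<close>

lemma schur_test:
  fixes a w :: "'a \<Rightarrow> real" and \<kappa> :: "'a \<Rightarrow> 'a \<Rightarrow> real"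
  assumes "finite P" and w: "\<And>p. p \<in> P \<Longrightarrow> 0 < w p"
    and sym: "\<And>p q. \<kappa> p q = \<kappa> q p" and nonneg: "\<And>p q. 0 \<le> \<kappa> p q"
    and W: "\<And>p. p \<in> P \<Longrightarrow> (\<Sum>q\<in>P. w q * \<kappa> p q) \<le> W"
  shows "(\<Sum>p\<in>P. \<Sum>q\<in>P. a p * a q * \<kappa> p q) \<le> W * (\<Sum>p\<in>P. (a p)\<^sup>2 / w p)"
proof -
  have amgm: "a p * a q \<le> ((a p)\<^sup>2 / w p * w q + (a q)\<^sup>2 / w q * w p) / 2" if "p \<in> P" "q \<in> P" for p q
  proof -
    have "0 \<le> (a p * w q - a q * w p)\<^sup>2 / (2 * w p * w q)"
      using w that by (intro divide_nonneg_nonneg) (auto simp: less_imp_le)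
    also have "\<dots> = ((a p)\<^sup>2 / w p * w q + (a q)\<^sup>2 / w q * w p) / 2 - a p * a q"
      using w[OF that(1)] w[OF that(2)] by (simp add: field_simps power2_eq_square)
    finally show ?thesis by simp
  qed
  have "(\<Sum>p\<in>P. \<Sum>q\<in>P. a p * a q * \<kappa> p q)
    \<le> (\<Sum>p\<in>P. \<Sum>q\<in>P. ((a p)\<^sup>2 / w p * w q + (a q)\<^sup>2 / w q * w p) / 2 * \<kappa> p q)"
    by (intro sum_mono mult_right_mono amgm nonneg)
  also have "\<dots> = ((\<Sum>p\<in>P. \<Sum>q\<in>P. (a p)\<^sup>2 / w p * (w q * \<kappa> p q)) + (\<Sum>p\<in>P. \<Sum>q\<in>P. (a q)\<^sup>2 / w q * (w p * \<kappa> q p))) / 2"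
    unfolding sum.distrib[symmetric] sum_divide_distrib by (intro sum.cong refl) (simp add: sym algebra_simps add_divide_distrib)
  also have "(\<Sum>p\<in>P. \<Sum>q\<in>P. (a q)\<^sup>2 / w q * (w p * \<kappa> q p)) = (\<Sum>p\<in>P. \<Sum>q\<in>P. (a p)\<^sup>2 / w p * (w q * \<kappa> p q))"
    by (rule sum.swap)
  also have "((\<Sum>p\<in>P. \<Sum>q\<in>P. (a p)\<^sup>2 / w p * (w q * \<kappa> p q)) + (\<Sum>p\<in>P. \<Sum>q\<in>P. (a p)\<^sup>2 / w p * (w q * \<kappa> p q))) / 2
     = (\<Sum>p\<in>P. (a p)\<^sup>2 / w p * (\<Sum>q\<in>P. w q * \<kappa> p q))"
    by (simp only: sum_distrib_left) simp
  also have "\<dots> \<le> (\<Sum>p\<in>P. (a p)\<^sup>2 / w p * W)"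
    using w by (intro sum_mono mult_left_mono W) (auto simp: less_imp_le)
  finally show ?thesis by (simp add: sum_distrib_left mult.commute)
qed

lemma l4l4_evolution_eq:
  assumes "finite S"
  shows "set_integrable lebesgue {0..T} (\<lambda>t. besicovitch_norm 4 (evolution S c \<mu> \<phi> t) ^ 4)" (is ?th1)
    and "(LINT t:{0..T}|lebesgue. besicovitch_norm 4 (evolution S c \<mu> \<phi> t) ^ 4)
      = Re (LINT t:{0..T}|lebesgue. evolution_quartic S c \<mu> \<phi> t)" (is ?th2)
proof -
  have e: "besicovitch_norm 4 (evolution S c \<mu> \<phi> t) ^ 4 = Re (evolution_quartic S c \<mu> \<phi> t)" for t
    using besicovitch_norm_power(1)[OF has_mean_evolution_power4[OF assms]] by simp
  have i: "integrable lebesgue (\<lambda>t. indicator {0..T} t *\<^sub>R evolution_quartic S c \<mu> \<phi> t)"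
    using set_integrable_lebesgue_continuous[OF continuous_evolution_quartic] unfolding set_integrable_def .
  show ?th1 using integrable_Re[OF i] unfolding e set_integrable_def by simp
  show ?th2 using integral_Re[OF i] unfolding e set_lebesgue_integral_def by simp
qed

text \<open>The Schur test is run on pairs of indices. Coefficients and weights are products over a
  pair, so the final sum over pairs is the square of a sum over single indices.\<close>

lemma LINT_evolution_le:
  assumes "finite S" "0 < T" and v: "\<And>n. n \<in> S \<Longrightarrow> 0 < v n"
    and W: "\<And>m n. m \<in> S \<Longrightarrow> n \<in> S \<Longrightarrow> (\<Sum>(k, l)\<in>S \<times> S. v k * v l *
       (if \<mu> m + \<mu> n = \<mu> k + \<mu> l then 3 * T / (1 + T * \<bar>\<phi> m + \<phi> n - (\<phi> k + \<phi> l)\<bar>) else 0)) \<le> W"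
  shows "(LINT t:{0..T}|lebesgue. besicovitch_norm 4 (evolution S c \<mu> \<phi> t) ^ 4)
    \<le> W * (\<Sum>n\<in>S. (cmod (c n))\<^sup>2 / v n)\<^sup>2"
proof -
  let ?P = "S \<times> S"
  let ?a = "\<lambda>p. cmod (c (fst p)) * cmod (c (snd p))"
  let ?w = "\<lambda>p. v (fst p) * v (snd p)"
  let ?\<kappa> = "\<lambda>p q. if \<mu> (fst p) + \<mu> (snd p) = \<mu> (fst q) + \<mu> (snd q)
     then 3 * T / (1 + T * \<bar>\<phi> (fst p) + \<phi> (snd p) - (\<phi> (fst q) + \<phi> (snd q))\<bar>) else 0"
  let ?g = "\<lambda>p q t. if \<mu> (fst p) + \<mu> (snd p) = \<mu> (fst q) + \<mu> (snd q)
     then c (fst p) * c (snd p) * cnj (c (fst q) * c (snd q)) *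
       exp (\<i> * complex_of_real ((\<phi> (fst q) + \<phi> (snd q) - (\<phi> (fst p) + \<phi> (snd p))) * t)) else 0"
  have gi: "set_integrable lebesgue {0..T} (?g p q)" for p q
    by (cases "\<mu> (fst p) + \<mu> (snd p) = \<mu> (fst q) + \<mu> (snd q)")
      (auto intro!: set_integrable_lebesgue_continuous continuous_intros)
  have g: "cmod (LINT t:{0..T}|lebesgue. ?g p q t) \<le> ?a p * ?a q * ?\<kappa> p q" for p q
  proof (cases "\<mu> (fst p) + \<mu> (snd p) = \<mu> (fst q) + \<mu> (snd q)")
    case True
    have "cmod (LINT t:{0..T}|lebesgue. ?g p q t) = ?a p * ?a q * cmod (LINT t:{0..T}|lebesgue.
        exp (\<i> * complex_of_real ((\<phi> (fst q) + \<phi> (snd q) - (\<phi> (fst p) + \<phi> (snd p))) * t)))"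
      using True by (simp add: norm_mult)
    also have "\<dots> \<le> ?a p * ?a q * (3 * T / (1 + T * \<bar>\<phi> (fst q) + \<phi> (snd q) - (\<phi> (fst p) + \<phi> (snd p))\<bar>))"
      by (intro mult_left_mono norm_time_integral_exp_le assms) auto
    finally show ?thesis using True by (simp add: abs_minus_commute)
  qed (simp add: set_lebesgue_integral_def)
  have "(LINT t:{0..T}|lebesgue. besicovitch_norm 4 (evolution S c \<mu> \<phi> t) ^ 4)
      \<le> cmod (LINT t:{0..T}|lebesgue. evolution_quartic S c \<mu> \<phi> t)"
    unfolding l4l4_evolution_eq(2)[OF assms(1)] by (rule complex_Re_le_cmod)
  also have "(LINT t:{0..T}|lebesgue. evolution_quartic S c \<mu> \<phi> t) = (\<Sum>p\<in>?P. \<Sum>q\<in>?P. LINT t:{0..T}|lebesgue. ?g p q t)"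
    using gi unfolding evolution_quartic_def case_prod_beta set_integrable_def set_lebesgue_integral_def
    by (simp only: scaleR_sum_right Bochner_Integration.integral_sum Bochner_Integration.integrable_sum)
  also have "cmod \<dots> \<le> (\<Sum>p\<in>?P. \<Sum>q\<in>?P. ?a p * ?a q * ?\<kappa> p q)"
    by (intro sum_norm_le g)
  also have "\<dots> \<le> W * (\<Sum>p\<in>?P. (?a p)\<^sup>2 / ?w p)"
  proof (rule schur_test)
    show "(\<Sum>q\<in>?P. ?w q * ?\<kappa> p q) \<le> W" if "p \<in> ?P" for p
      using W[of "fst p" "snd p"] that by (simp add: case_prod_beta mem_Times_iff)
  qed (use assms(1,2) v in \<open>auto simp: abs_minus_commute\<close>)
  also have "(\<Sum>p\<in>?P. (?a p)\<^sup>2 / ?w p) = (\<Sum>n\<in>S. (cmod (c n))\<^sup>2 / v n)\<^sup>2"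
    by (simp add: power2_eq_square sum_product sum.cartesian_product case_prod_beta mult.assoc mult.left_commute)
  finally show ?thesis .
qed

section \<open>Lattice sums\<close>

lemma inj_freq:
  assumes "nonresonant \<omega>"
  shows "inj (freq \<omega>)"
proof (rule injI)
  fix m n assume "freq \<omega> m = freq \<omega> n"
  then have "(\<Sum>i\<in>UNIV. of_rat (rat_of_int (m $ i - n $ i)) * \<omega> $ i) = 0"
    unfolding of_rat_of_int_eq
    by (simp add: freq_def lattice_vec_def inner_vec_def left_diff_distrib sum_subtractf)
  from assms[unfolded nonresonant_def, rule_format, OF this] show "m = n" by (simp add: vec_eq_iff)
qed

text \<open>Comparison with an integral: each term is at most an increment of \<open>arctan\<close>
  divided by \<open>\<gamma>\<close>, by the mean value theorem, and the increments telescope to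
  less than \<open>pi / 2\<close>.\<close>

lemma sum_inverse_one_plus_square_le:
  assumes "0 < \<gamma>"
  shows "(\<Sum>m=1..M. 1 / (1 + (\<gamma> * real m)\<^sup>2)) \<le> pi / (2 * \<gamma>)"
proof -
  have step: "1 / (1 + (\<gamma> * real (Suc m))\<^sup>2) \<le> (arctan (\<gamma> * real (Suc m)) - arctan (\<gamma> * real m)) / \<gamma>" for m
  proof -
    obtain z where z: "\<gamma> * real m < z" "z < \<gamma> * real (Suc m)"
      and eq: "arctan (\<gamma> * real (Suc m)) - arctan (\<gamma> * real m) = (\<gamma> * real (Suc m) - \<gamma> * real m) * inverse (1 + z\<^sup>2)"
      using MVT2[of "\<gamma> * real m" "\<gamma> * real (Suc m)" arctan "\<lambda>x. inverse (1 + x\<^sup>2)"] assms DERIV_arctan by auto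
    have "0 \<le> \<gamma> * real m" using assms by simp
    then have "z\<^sup>2 \<le> (\<gamma> * real (Suc m))\<^sup>2" using z by (intro power_mono) auto
    then have "1 / (1 + (\<gamma> * real (Suc m))\<^sup>2) \<le> inverse (1 + z\<^sup>2)"
      unfolding inverse_eq_divide by (intro divide_left_mono mult_pos_pos) (auto simp: add_pos_nonneg)
    then show ?thesis unfolding eq using assms by (simp add: algebra_simps)
  qed
  have "(\<Sum>m=1..M. 1 / (1 + (\<gamma> * real m)\<^sup>2)) \<le> arctan (\<gamma> * real M) / \<gamma>"
  proof (induction M)
    case (Suc M)
    then show ?case using step[of M] by (simp add: diff_divide_distrib)
  qed simp
  also have "\<dots> \<le> (pi / 2) / \<gamma>" using assms arctan_ubound by (intro divide_right_mono) (auto simp: less_imp_le)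
  finally show ?thesis by simp
qed

text \<open>The integer \<open>k0\<close> nearest to the peak \<open>- a / \<beta>\<close>
  contributes at most 1, and the integers on each side at most \<open>pi / \<beta>\<close>. The
  bound is uniform in the shift \<open>a\<close>, which may later depend on frozen
  variables.\<close>

lemma sum_int_lorentzian_le:
  fixes K :: "int set"
  assumes "finite K" "0 < \<beta>"
  shows "(\<Sum>k\<in>K. 1 / (1 + (\<beta> * real_of_int k + a)\<^sup>2)) \<le> 1 + 2 * pi / \<beta>"
proof -
  define \<gamma> where "\<gamma> = \<beta> / 2"
  have \<gamma>: "0 < \<gamma>" using assms by (simp add: \<gamma>_def)
  define k0 where "k0 = round (- a / \<beta>)"
  define f where "f x = 1 / (1 + (\<gamma> * x)\<^sup>2)" for x :: real
  have f0: "0 \<le> f x" for x by (simp add: f_def)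
  obtain M :: nat where M: "\<And>k. k \<in> K \<Longrightarrow> \<bar>k - k0\<bar> \<le> int M"
  proof
    fix k assume "k \<in> K"
    then have "\<bar>k - k0\<bar> \<le> (\<Sum>k\<in>K. \<bar>k - k0\<bar>)" using assms(1) by (intro member_le_sum) auto
    then show "\<bar>k - k0\<bar> \<le> int (nat (\<Sum>k\<in>K. \<bar>k - k0\<bar>))" by simp
  qed
  let ?U = "(\<lambda>m. k0 + int m) ` {1..M}" and ?V = "(\<lambda>m. k0 - int m) ` {1..M}"
  have sub: "K \<subseteq> insert k0 (?U \<union> ?V)"
  proof
    fix k assume k: "k \<in> K"
    then consider "k = k0" | "k > k0" | "k < k0" by linarith
    then show "k \<in> insert k0 (?U \<union> ?V)"
    proof cases
      case 2
      then have "k = k0 + int (nat (k - k0))" "nat (k - k0) \<in> {1..M}" using M[OF k] by auto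
      then show ?thesis by blast
    next
      case 3
      then have "k = k0 - int (nat (k0 - k))" "nat (k0 - k) \<in> {1..M}" using M[OF k] by auto
      then show ?thesis by blast
    qed simp
  qed
  have "1 / (1 + (\<beta> * real_of_int k + a)\<^sup>2) \<le> f (real_of_int (k - k0))" for k
  proof -
    \<comment> \<open>The rounding error is at most 1/2, hence at most half of the distance from
      \<open>k\<close> to \<open>k0\<close> once these differ; this is why \<open>\<gamma>\<close>
      is half of \<open>\<beta>\<close>.\<close>
    have "\<gamma> * \<bar>real_of_int (k - k0)\<bar> \<le> \<bar>\<beta> * real_of_int k + a\<bar>"
    proof (cases "k = k0")
      case False
      have "\<bar>real_of_int k0 - (- a / \<beta>)\<bar> \<le> 1 / 2" unfolding k0_def by (rule of_int_round_abs_le)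
      moreover have "1 \<le> \<bar>real_of_int (k - k0)\<bar>" using False by linarith
      ultimately have "\<bar>real_of_int (k - k0)\<bar> / 2 \<le> \<bar>real_of_int k - (- a / \<beta>)\<bar>" unfolding of_int_diff by (smt (verit) field_sum_of_halves)
      then have "\<beta> * (\<bar>real_of_int (k - k0)\<bar> / 2) \<le> \<beta> * \<bar>real_of_int k - (- a / \<beta>)\<bar>"
        using assms(2) by (intro mult_left_mono) auto
      also have "\<dots> = \<bar>\<beta> * (real_of_int k - (- a / \<beta>))\<bar>" using assms(2) by (simp add: abs_mult)
      also have "\<beta> * (real_of_int k - (- a / \<beta>)) = \<beta> * real_of_int k + a" using assms(2) by (simp add: field_simps)
      finally show ?thesis by (simp add: \<gamma>_def)
    qed simp
    then have "(\<gamma> * \<bar>real_of_int (k - k0)\<bar>)\<^sup>2 \<le> \<bar>\<beta> * real_of_int k + a\<bar>\<^sup>2"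
      using \<gamma> by (intro power_mono) auto
    then show ?thesis
      unfolding f_def by (intro divide_left_mono mult_pos_pos) (auto simp: power_mult_distrib add_pos_nonneg)
  qed
  then have "(\<Sum>k\<in>K. 1 / (1 + (\<beta> * real_of_int k + a)\<^sup>2)) \<le> (\<Sum>k\<in>K. f (real_of_int (k - k0)))"
    by (rule sum_mono)
  also have "\<dots> \<le> (\<Sum>k\<in>insert k0 (?U \<union> ?V). f (real_of_int (k - k0)))"
    by (intro sum_mono2 sub f0) auto
  also have "\<dots> = f 0 + (\<Sum>k\<in>?U \<union> ?V. f (real_of_int (k - k0)))"
    by (subst sum.insert) auto
  also have "(\<Sum>k\<in>?U \<union> ?V. f (real_of_int (k - k0))) = (\<Sum>k\<in>?U. f (real_of_int (k - k0))) + (\<Sum>k\<in>?V. f (real_of_int (k - k0)))"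
    by (rule sum.union_disjoint) auto
  also have "(\<Sum>k\<in>?U. f (real_of_int (k - k0))) = (\<Sum>m=1..M. f (real m))"
    by (subst sum.reindex) (auto simp: inj_on_def)
  also have "(\<Sum>k\<in>?V. f (real_of_int (k - k0))) = (\<Sum>m=1..M. f (real m))"
    by (subst sum.reindex) (auto simp: inj_on_def f_def)
  also have "f 0 + ((\<Sum>m=1..M. f (real m)) + (\<Sum>m=1..M. f (real m))) \<le> 1 + (pi / (2 * \<gamma>) + pi / (2 * \<gamma>))"
    using sum_inverse_one_plus_square_le[OF \<gamma>, of M] by (intro add_mono) (auto simp: f_def)
  also have "\<dots> = 1 + 2 * pi / \<beta>" by (simp add: \<gamma>_def)
  finally show ?thesis .
qed

lemma freq_split: "freq \<omega> n = (\<Sum>i\<in>-{j}. real_of_int (n $ i) * \<omega> $ i) + real_of_int (n $ j) * \<omega> $ j"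
proof -
  have "UNIV = insert j (-{j})" by auto
  then show ?thesis
    unfolding freq_def lattice_vec_def inner_vec_def
    by (metis (no_types, lifting) Compl_iff add.commute finite inner_real_def insertI1 sum.cong sum.insert vec_lambda_beta)
qed

lemma sum_lattice_lorentzian_le:
  fixes \<omega> :: "real ^ 'n" and F :: "(int ^ 'n) set"
  assumes "finite F" and g0: "\<And>k. 0 \<le> g k" and G: "\<And>K. finite K \<Longrightarrow> (\<Sum>k\<in>K. g k) \<le> G"
    and "0 < \<gamma>" "0 < \<omega> $ j"
  shows "(\<Sum>n\<in>F. (\<Prod>i\<in>-{j}. g (n $ i)) * (1 / (1 + (\<gamma> * freq \<omega> n + a)\<^sup>2)))
    \<le> G ^ (CARD('n) - 1) * (1 + 2 * pi / (\<gamma> * \<omega> $ j))"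
proof -
  \<comment> \<open>One finite set containing all coordinates of all points: \<open>F\<close> embeds
    into a box over \<open>K\<close>, and enlarging to the box is harmless as all terms are
    nonnegative.\<close>
  define K where "K = (\<Union>i. (\<lambda>n. n $ i) ` F)"
  have K: "finite K" using assms(1) unfolding K_def by auto
  let ?A = "Pi\<^sub>E (-{j}) (\<lambda>_. K)"
  let ?r = "\<lambda>n :: int ^ 'n. (restrict (\<lambda>i. n $ i) (-{j}), n $ j)"
  let ?s = "\<lambda>f. \<Sum>i\<in>-{j}. real_of_int (f i) * \<omega> $ i"
  let ?H = "\<lambda>(f, k). (\<Prod>i\<in>-{j}. g (f i)) * (1 / (1 + (\<gamma> * (?s f + real_of_int k * \<omega> $ j) + a)\<^sup>2))"
  have G0: "0 \<le> G" using G[of "{}"] by simp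
  have inj: "inj_on ?r F"
  proof (rule inj_onI)
    fix m n assume *: "?r m = ?r n"
    have "m $ i = n $ i" for i
    proof (cases "i = j")
      case False
      then have "restrict (\<lambda>i. m $ i) (-{j}) i = restrict (\<lambda>i. n $ i) (-{j}) i" using * by simp
      then show ?thesis using False by simp
    qed (use * in simp)
    then show "m = n" by (simp add: vec_eq_iff)
  qed
  have "(\<Sum>n\<in>F. (\<Prod>i\<in>-{j}. g (n $ i)) * (1 / (1 + (\<gamma> * freq \<omega> n + a)\<^sup>2))) = (\<Sum>n\<in>F. ?H (?r n))"
    unfolding freq_split[of \<omega> _ j] by simp
  also have "\<dots> = (\<Sum>p\<in>?r ` F. ?H p)" using inj by (simp add: sum.reindex)
  also have "\<dots> \<le> (\<Sum>p\<in>?A \<times> K. ?H p)"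
  proof (rule sum_mono2)
    show "finite (?A \<times> K)" using K by (intro finite_cartesian_product finite_PiE) auto
    have "n $ i \<in> K" if "n \<in> F" for n i using that unfolding K_def by blast
    then show "?r ` F \<subseteq> ?A \<times> K"
      by (intro image_subsetI) (simp only: mem_Times_iff fst_conv snd_conv restrict_PiE_iff, blast)
  qed (auto intro!: divide_nonneg_nonneg prod_nonneg g0)
  also have "\<dots> = (\<Sum>f\<in>?A. (\<Prod>i\<in>-{j}. g (f i)) * (\<Sum>k\<in>K. 1 / (1 + ((\<gamma> * \<omega> $ j) * real_of_int k + (\<gamma> * ?s f + a))\<^sup>2)))"
    unfolding sum.cartesian_product[symmetric]
    by (intro sum.cong refl, subst sum_distrib_left, intro sum.cong refl) (simp add: algebra_simps)
  also have "\<dots> \<le> (\<Sum>f\<in>?A. (\<Prod>i\<in>-{j}. g (f i)) * (1 + 2 * pi / (\<gamma> * \<omega> $ j)))"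
    using assms by (intro sum_mono mult_left_mono sum_int_lorentzian_le K prod_nonneg) auto
  also have "\<dots> = (\<Prod>i\<in>-{j}. \<Sum>k\<in>K. g k) * (1 + 2 * pi / (\<gamma> * \<omega> $ j))"
    by (subst prod_sum_PiE) (auto simp: K sum_distrib_right)
  also have "(\<Prod>i\<in>-{j}. \<Sum>k\<in>K. g k) \<le> (\<Prod>i\<in>-{j}. G)"
    by (intro prod_mono) (auto intro!: sum_nonneg g0 G K)
  also have "\<dots> = G ^ (CARD('n) - 1)" by (simp add: Compl_eq_Diff_UNIV)
  finally show ?thesis using assms by (simp add: mult_right_mono add_nonneg_nonneg)
qed

text \<open>Injectivity determines \<open>l\<close> from \<open>k\<close> on the line
  \<open>\<mu> k + \<mu> l = M\<close>, so the double sum collapses. The point is to replace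
  \<open>v k * v l\<close> by \<open>(v k)\<^sup>2\<close>, a weight in \<open>k\<close>
  alone.\<close>

lemma sum_pairs_on_diagonal_le:
  fixes v h \<mu> :: "'a \<Rightarrow> real"
  assumes "finite S" "inj_on \<mu> S"
    and h0: "\<And>k. k \<in> S \<Longrightarrow> 0 \<le> h k" and v0: "\<And>k. k \<in> S \<Longrightarrow> 0 \<le> v k"
    and \<kappa>: "\<And>k l. k \<in> S \<Longrightarrow> l \<in> S \<Longrightarrow> \<mu> k + \<mu> l = M \<Longrightarrow> \<kappa> k l \<le> h k"
    and sym: "\<And>k l. \<kappa> k l = \<kappa> l k"
  shows "(\<Sum>(k, l)\<in>S \<times> S. v k * v l * (if M = \<mu> k + \<mu> l then \<kappa> k l else 0)) \<le> (\<Sum>k\<in>S. (v k)\<^sup>2 * h k)"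
proof -
  let ?f = "\<lambda>k l. if M = \<mu> k + \<mu> l then (v k)\<^sup>2 * h k else 0"
  have le: "v k * v l * (if M = \<mu> k + \<mu> l then \<kappa> k l else 0) \<le> (?f k l + ?f l k) / 2"
    if "k \<in> S" "l \<in> S" for k l
  proof (cases "M = \<mu> k + \<mu> l")
    case True
    have "\<kappa> k l \<le> h k" using that True by (intro \<kappa>) auto
    moreover have "\<kappa> l k \<le> h l" using that True by (intro \<kappa>) auto
    \<comment> \<open>Symmetry bounds the kernel by either of \<open>h k\<close> and
      \<open>h l\<close>; with the minimum, each of the two squares can afterwards be paired with
      its own \<open>h\<close>.\<close>
    ultimately have "\<kappa> k l \<le> min (h k) (h l)" using sym[of k l] by simp
    then have "v k * v l * \<kappa> k l \<le> v k * v l * min (h k) (h l)"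
      using v0 that by (intro mult_left_mono) auto
    also have "\<dots> \<le> ((v k)\<^sup>2 + (v l)\<^sup>2) / 2 * min (h k) (h l)"
      using sum_squares_bound[of "v k" "v l"] h0 that by (intro mult_right_mono) (auto simp: power2_eq_square)
    also have "\<dots> \<le> ((v k)\<^sup>2 * h k + (v l)\<^sup>2 * h l) / 2"
    proof -
      have "(v k)\<^sup>2 * min (h k) (h l) \<le> (v k)\<^sup>2 * h k" "(v l)\<^sup>2 * min (h k) (h l) \<le> (v l)\<^sup>2 * h l"
        by (intro mult_left_mono; simp)+
      then show ?thesis by (simp add: algebra_simps)
    qed
    finally show ?thesis using True by (simp add: add.commute)
  qed simp
  have "(\<Sum>(k, l)\<in>S \<times> S. v k * v l * (if M = \<mu> k + \<mu> l then \<kappa> k l else 0))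
    \<le> (\<Sum>k\<in>S. \<Sum>l\<in>S. (?f k l + ?f l k) / 2)"
    unfolding sum.cartesian_product[symmetric] by (intro sum_mono le)
  also have "\<dots> = ((\<Sum>k\<in>S. \<Sum>l\<in>S. ?f k l) + (\<Sum>k\<in>S. \<Sum>l\<in>S. ?f l k)) / 2"
    by (simp add: sum.distrib flip: sum_divide_distrib)
  also have "(\<Sum>k\<in>S. \<Sum>l\<in>S. ?f l k) = (\<Sum>k\<in>S. \<Sum>l\<in>S. ?f k l)" by (rule sum.swap)
  also have "((\<Sum>k\<in>S. \<Sum>l\<in>S. ?f k l) + (\<Sum>k\<in>S. \<Sum>l\<in>S. ?f k l)) / 2 = (\<Sum>k\<in>S. \<Sum>l\<in>S. ?f k l)" by simp
  also have "\<dots> \<le> (\<Sum>k\<in>S. (v k)\<^sup>2 * h k)"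
  proof (rule sum_mono)
    fix k assume k: "k \<in> S"
    let ?L = "{l\<in>S. M = \<mu> k + \<mu> l}"
    \<comment> \<open>At most one partner \<open>l\<close> exists because \<open>\<mu>\<close> is
      injective on \<open>S\<close>.\<close>
    have "card ?L \<le> Suc 0"
      using assms(1,2) by (subst card_le_Suc0_iff_eq) (auto simp: inj_on_def)
    then have "real (card ?L) * ((v k)\<^sup>2 * h k) \<le> 1 * ((v k)\<^sup>2 * h k)"
      using h0[OF k] by (intro mult_right_mono) auto
    moreover have "(\<Sum>l\<in>S. ?f k l) = real (card ?L) * ((v k)\<^sup>2 * h k)"
      using assms(1) by (simp add: sum.inter_filter[symmetric])
    ultimately show "(\<Sum>l\<in>S. ?f k l) \<le> (v k)\<^sup>2 * h k" by simp
  qed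
  finally show ?thesis .
qed

text \<open>The shifts \<open>a\<close> and \<open>b\<close> may depend on \<open>m\<close> and
  \<open>n\<close>, while \<open>A\<close> and \<open>\<gamma>\<close> may not: Lorentzian sums are
  uniform in the shift. The constant 6 is 3 from the time integral times two Lorentzians.\<close>

lemma LINT_lattice_evolution_le:
  fixes \<omega> :: "real ^ 'n" and S :: "(int ^ 'n) set"
  assumes fin: "finite S" and T: "0 < T" and inj: "inj (freq \<omega>)"
    and v: "\<And>n. n \<in> S \<Longrightarrow> 0 < v n" and vg: "\<And>n. n \<in> S \<Longrightarrow> (v n)\<^sup>2 \<le> (\<Prod>i\<in>-{j}. g (n $ i))"
    and g0: "\<And>k. 0 \<le> g k" and G: "\<And>K. finite K \<Longrightarrow> (\<Sum>k\<in>K. g k) \<le> G"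
    and \<gamma>: "0 < \<gamma>" and \<omega>: "0 < \<omega> $ j" and A: "0 \<le> A"
    and ph: "\<And>m n. m \<in> S \<Longrightarrow> n \<in> S \<Longrightarrow> \<exists>a b. \<forall>k\<in>S. \<forall>l\<in>S. freq \<omega> k + freq \<omega> l = freq \<omega> m + freq \<omega> n \<longrightarrow>
        1 / (1 + T * \<bar>\<phi> m + \<phi> n - (\<phi> k + \<phi> l)\<bar>)
        \<le> A * (1 / (1 + (\<gamma> * freq \<omega> k + a)\<^sup>2) + 1 / (1 + (\<gamma> * freq \<omega> k + b)\<^sup>2))"
  shows "(LINT t:{0..T}|lebesgue. besicovitch_norm 4 (evolution S c (freq \<omega>) \<phi> t) ^ 4)
    \<le> 6 * A * T * G ^ (CARD('n) - 1) * (1 + 2 * pi / (\<gamma> * \<omega> $ j)) * (\<Sum>n\<in>S. (cmod (c n))\<^sup>2 / v n)\<^sup>2"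
proof (rule LINT_evolution_le[OF fin T v])
  fix m n assume mn: "m \<in> S" "n \<in> S"
  obtain a b where ab: "\<And>k l. k \<in> S \<Longrightarrow> l \<in> S \<Longrightarrow> freq \<omega> k + freq \<omega> l = freq \<omega> m + freq \<omega> n \<Longrightarrow>
        1 / (1 + T * \<bar>\<phi> m + \<phi> n - (\<phi> k + \<phi> l)\<bar>)
        \<le> A * (1 / (1 + (\<gamma> * freq \<omega> k + a)\<^sup>2) + 1 / (1 + (\<gamma> * freq \<omega> k + b)\<^sup>2))"
    using ph[OF mn] by blast
  let ?p = "\<lambda>k :: int ^ 'n. \<Prod>i\<in>-{j}. g (k $ i)"
  let ?q = "\<lambda>a k. 1 / (1 + (\<gamma> * freq \<omega> k + a)\<^sup>2)"
  have "(\<Sum>(k, l)\<in>S \<times> S. v k * v l * (if freq \<omega> m + freq \<omega> n = freq \<omega> k + freq \<omega> l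
        then 3 * T / (1 + T * \<bar>\<phi> m + \<phi> n - (\<phi> k + \<phi> l)\<bar>) else 0))
     \<le> (\<Sum>k\<in>S. (v k)\<^sup>2 * (3 * T * (A * (?q a k + ?q b k))))"
  proof (rule sum_pairs_on_diagonal_le[OF fin])
    show "3 * T / (1 + T * \<bar>\<phi> m + \<phi> n - (\<phi> k + \<phi> l)\<bar>) \<le> 3 * T * (A * (?q a k + ?q b k))"
      if "k \<in> S" "l \<in> S" "freq \<omega> k + freq \<omega> l = freq \<omega> m + freq \<omega> n" for k l
      using mult_left_mono[OF ab[OF that], of "3 * T"] T by simp
  qed (use inj T A v in \<open>auto simp: inj_on_def inj_def add.commute less_imp_le\<close>)
  also have "\<dots> \<le> (\<Sum>k\<in>S. ?p k * (3 * T * (A * (?q a k + ?q b k))))"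
    using T A by (intro sum_mono mult_right_mono vg) auto
  also have "\<dots> = 3 * T * A * ((\<Sum>k\<in>S. ?p k * ?q a k) + (\<Sum>k\<in>S. ?p k * ?q b k))"
    by (simp only: sum.distrib[symmetric] sum_distrib_left) (simp add: algebra_simps)
  also have "\<dots> \<le> 3 * T * A * (G ^ (CARD('n) - 1) * (1 + 2 * pi / (\<gamma> * \<omega> $ j)) + G ^ (CARD('n) - 1) * (1 + 2 * pi / (\<gamma> * \<omega> $ j)))"
    using T A by (intro mult_left_mono add_mono sum_lattice_lorentzian_le fin g0 G \<gamma> \<omega>) auto
  finally show "(\<Sum>(k, l)\<in>S \<times> S. v k * v l * (if freq \<omega> m + freq \<omega> n = freq \<omega> k + freq \<omega> l
        then 3 * T / (1 + T * \<bar>\<phi> m + \<phi> n - (\<phi> k + \<phi> l)\<bar>) else 0))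
     \<le> 6 * A * T * G ^ (CARD('n) - 1) * (1 + 2 * pi / (\<gamma> * \<omega> $ j))" by (simp add: algebra_simps)
qed

text \<open>The point is that \<open>\<bar>x\<^sup>2 - y\<^sup>2\<bar> = \<bar>y - x\<bar> * \<bar>y + x\<bar>\<close> is at least the smaller of the two squares.\<close>

lemma quadratic_phase_le:
  fixes x y D :: real
  assumes "D > 0"
  shows "1 / (1 + D * \<bar>x\<^sup>2 - y\<^sup>2\<bar>) \<le> 1 / (1 + (sqrt D * (y - x))\<^sup>2) + 1 / (1 + (sqrt D * (y + x))\<^sup>2)"
proof -
  have *: "1 / (1 + D * \<bar>x\<^sup>2 - y\<^sup>2\<bar>) \<le> 1 / (1 + (sqrt D * z)\<^sup>2)" if "z\<^sup>2 \<le> \<bar>x\<^sup>2 - y\<^sup>2\<bar>" for z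
    using assms that by (intro divide_left_mono mult_pos_pos) (auto simp: power_mult_distrib add_pos_nonneg)
  have eq: "\<bar>x\<^sup>2 - y\<^sup>2\<bar> = \<bar>y - x\<bar> * \<bar>y + x\<bar>"
    by (simp add: abs_mult[symmetric] power2_eq_square algebra_simps abs_minus_commute)
  show ?thesis
  proof (cases "\<bar>y - x\<bar> \<le> \<bar>y + x\<bar>")
    case True
    have "(y - x)\<^sup>2 \<le> \<bar>x\<^sup>2 - y\<^sup>2\<bar>"
      using mult_left_mono[of "\<bar>y - x\<bar>" "\<bar>y + x\<bar>" "\<bar>y - x\<bar>"] True unfolding eq by (simp add: power2_eq_square)
    from *[OF this] show ?thesis by (smt (verit) divide_nonneg_nonneg zero_le_power2)
  next
    case False
    have "(y + x)\<^sup>2 \<le> \<bar>x\<^sup>2 - y\<^sup>2\<bar>"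
      using mult_right_mono[of "\<bar>y + x\<bar>" "\<bar>y - x\<bar>" "\<bar>y + x\<bar>"] False unfolding eq by (simp add: power2_eq_square)
    from *[OF this] show ?thesis by (smt (verit) divide_nonneg_nonneg zero_le_power2)
  qed
qed

section \<open>Minkowski and Bessel inequalities\<close>

text \<open>Both conditions guard against default values: the mean makes
  \<open>besicovitch_norm 4\<close> meaningful at each time, and integrability does the same for the
  time integral.\<close>

definition l4l4_integrable :: "real \<Rightarrow> (real \<Rightarrow> real \<Rightarrow> complex) \<Rightarrow> bool" where
  "l4l4_integrable T F \<longleftrightarrow> (\<forall>t. \<exists>m. has_mean (\<lambda>x. cmod (F t x) ^ 4) m)
     \<and> set_integrable lebesgue {0..T} (\<lambda>t. besicovitch_norm 4 (F t) ^ 4)"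

lemma l4l4_integrable_evolution: "finite S \<Longrightarrow> l4l4_integrable T (evolution S c \<mu> \<phi>)"
  unfolding l4l4_integrable_def using has_mean_evolution_power4 l4l4_evolution_eq(1) by blast

lemma besicovitch_norm_nonneg: "0 \<le> besicovitch_norm p f"
  by (simp add: besicovitch_norm_def)

lemma l4l4_norm_nonneg: "0 \<le> l4l4_norm T F"
  by (simp add: l4l4_norm_def)

lemma l4l4_norm_power4: "l4l4_norm T F ^ 4 = (LINT t:{0..T}|lebesgue. besicovitch_norm 4 (F t) ^ 4)"
proof -
  let ?I = "LINT t:{0..T}|lebesgue. besicovitch_norm 4 (F t) ^ 4"
  have "0 \<le> ?I" unfolding set_lebesgue_integral_def by (intro integral_nonneg_AE AE_I2) simp
  moreover have "(?I powr (1 / 4)) ^ 4 = (?I powr (1 / 4)) powr 4" if "?I \<noteq> 0"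
    using that powr_realpow[of "?I powr (1 / 4)" 4] by simp
  ultimately show ?thesis unfolding l4l4_norm_def by (cases "?I = 0") (auto simp: powr_powr)
qed

text \<open>Convexity of the fourth power, obtained by applying convexity of the square twice at
  \<open>norm a / \<theta>\<close> and \<open>norm b / (1 - \<theta>)\<close>. Being linear in the
  fourth powers, the inequality passes to means and time integrals.\<close>

lemma norm_add_power4_le:
  fixes a b :: "'a::real_normed_vector"
  assumes "0 < \<theta>" "\<theta> < 1"
  shows "norm (a + b) ^ 4 \<le> norm a ^ 4 / \<theta> ^ 3 + norm b ^ 4 / (1 - \<theta>) ^ 3"
proof -
  have sq: "(\<theta> * x + (1 - \<theta>) * y)\<^sup>2 \<le> \<theta> * x\<^sup>2 + (1 - \<theta>) * y\<^sup>2" for x y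
  proof -
    have "\<theta> * x\<^sup>2 + (1 - \<theta>) * y\<^sup>2 - (\<theta> * x + (1 - \<theta>) * y)\<^sup>2 = \<theta> * (1 - \<theta>) * (x - y)\<^sup>2"
      by (simp add: power2_eq_square algebra_simps)
    then show ?thesis using assms by (smt (verit) mult_nonneg_nonneg zero_le_power2)
  qed
  let ?x = "norm a / \<theta>" and ?y = "norm b / (1 - \<theta>)"
  have "norm (a + b) ^ 4 \<le> (norm a + norm b) ^ 4" by (intro power_mono norm_triangle_ineq) simp
  also have "norm a + norm b = \<theta> * ?x + (1 - \<theta>) * ?y" using assms by simp
  also have "(\<theta> * ?x + (1 - \<theta>) * ?y) ^ 4 = ((\<theta> * ?x + (1 - \<theta>) * ?y)\<^sup>2)\<^sup>2" by simp
  also have "\<dots> \<le> (\<theta> * ?x\<^sup>2 + (1 - \<theta>) * ?y\<^sup>2)\<^sup>2" by (intro power_mono sq) simp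
  also have "\<dots> \<le> \<theta> * (?x\<^sup>2)\<^sup>2 + (1 - \<theta>) * (?y\<^sup>2)\<^sup>2" by (rule sq)
  also have "\<dots> = norm a ^ 4 / \<theta> ^ 3 + norm b ^ 4 / (1 - \<theta>) ^ 3"
    using assms by (simp add: power_divide power4_eq_xxxx power3_eq_cube)
  finally show ?thesis .
qed

text \<open>Minkowski's inequality by optimizing a convexity bound: \<open>\<theta>\<close> is fixed
  from the full space-time norms and used at every time and point. Integrability of \<open>H\<close>
  is assumed separately, since the means of \<open>F\<close> and \<open>G\<close> do not ensure one
  for the sum.\<close>

lemma l4l4_norm_add_le:
  assumes F: "l4l4_integrable T F" and G: "l4l4_integrable T G" and H: "l4l4_integrable T H"
    and eq: "\<And>t x. H t x = F t x + G t x"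
  shows "l4l4_norm T H \<le> l4l4_norm T F + l4l4_norm T G"
proof (rule field_le_epsilon)
  fix e :: real assume "0 < e"
  \<comment> \<open>The added \<open>e / 2\<close> keeps \<open>A\<close> and \<open>B\<close>
    positive even if a norm vanishes, so that \<open>\<theta>\<close> lies strictly between 0 and
    1.\<close>
  define A where "A = l4l4_norm T F + e / 2"
  define B where "B = l4l4_norm T G + e / 2"
  \<comment> \<open>With this choice
    \<open>A ^ 4 / \<theta> ^ 3 + B ^ 4 / (1 - \<theta>) ^ 3\<close> is exactly
    \<open>(A + B) ^ 4\<close>.\<close>
  define \<theta> where "\<theta> = A / (A + B)"
  have pos: "0 < A" "0 < B" using \<open>0 < e\<close> l4l4_norm_nonneg[of T F] l4l4_norm_nonneg[of T G] by (auto simp: A_def B_def)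
  have \<theta>: "0 < \<theta>" "\<theta> < 1" "1 - \<theta> = B / (A + B)" using pos by (auto simp: \<theta>_def field_simps)
  let ?n = "\<lambda>F t. besicovitch_norm 4 (F t) ^ 4"
  have le: "?n H t \<le> ?n F t / \<theta> ^ 3 + ?n G t / (1 - \<theta>) ^ 3" for t
  proof -
    obtain f g h where m: "has_mean (\<lambda>x. cmod (F t x) ^ 4) f" "has_mean (\<lambda>x. cmod (G t x) ^ 4) g" "has_mean (\<lambda>x. cmod (H t x) ^ 4) h"
      using F G H unfolding l4l4_integrable_def by blast
    have n: "?n F t = f" "?n G t = g" "?n H t = h"
      using besicovitch_norm_power(1)[OF m(1)] besicovitch_norm_power(1)[OF m(2)] besicovitch_norm_power(1)[OF m(3)] by simp_all
    have "h \<le> 1 / \<theta> ^ 3 * f + 1 / (1 - \<theta>) ^ 3 * g"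
      by (rule has_mean_le[OF m(3) has_mean_add[OF has_mean_cmult[OF m(1)] has_mean_cmult[OF m(2)]]])
        (use norm_add_power4_le[OF \<theta>(1,2)] eq in simp)
    then show ?thesis unfolding n by simp
  qed
  have i: "set_integrable lebesgue {0..T} (\<lambda>t. ?n F t / \<theta> ^ 3)" "set_integrable lebesgue {0..T} (\<lambda>t. ?n G t / (1 - \<theta>) ^ 3)"
    using F G unfolding l4l4_integrable_def by auto
  have "l4l4_norm T H ^ 4 \<le> (LINT t:{0..T}|lebesgue. ?n F t / \<theta> ^ 3 + ?n G t / (1 - \<theta>) ^ 3)"
    unfolding l4l4_norm_power4 using H le i unfolding l4l4_integrable_def
    by (intro set_integral_mono set_integral_add) auto
  also have "\<dots> = l4l4_norm T F ^ 4 / \<theta> ^ 3 + l4l4_norm T G ^ 4 / (1 - \<theta>) ^ 3"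
    unfolding l4l4_norm_power4 set_integral_add(2)[OF i] by simp
  also have "\<dots> \<le> A ^ 4 / \<theta> ^ 3 + B ^ 4 / (1 - \<theta>) ^ 3"
    using \<theta> \<open>0 < e\<close> by (intro add_mono divide_right_mono power_mono) (auto simp: A_def B_def l4l4_norm_nonneg)
  also have "\<dots> = (A + B) ^ 4"
    unfolding \<theta>(3) unfolding \<theta>_def using pos
    by (simp add: power_divide power4_eq_xxxx power3_eq_cube) (simp add: algebra_simps)
  finally have "l4l4_norm T H \<le> A + B"
    using pos power_mono_iff[of "l4l4_norm T H" "A + B" 4] l4l4_norm_nonneg[of T H] by simp
  then show "l4l4_norm T H \<le> l4l4_norm T F + l4l4_norm T G + e" by (simp add: A_def B_def)
qed

section \<open>Means and Fourier-Bohr coefficients of Besicovitch functions\<close>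

text \<open>Stated for filters so that it serves both for averages as \<open>L\<close> tends to
  infinity and for the net of finite partial sums.\<close>

lemma Cauchy_net_convergent:
  fixes f :: "'a \<Rightarrow> 'b::complete_space"
  assumes "F \<noteq> bot" "\<And>e. 0 < e \<Longrightarrow> \<exists>P. eventually P F \<and> (\<forall>x y. P x \<and> P y \<longrightarrow> dist (f x) (f y) < e)"
  shows "\<exists>l. (f \<longlongrightarrow> l) F"
proof -
  have "cauchy_filter (filtermap f F)" unfolding cauchy_filter_metric_filtermap using assms(2) by blast
  moreover have "filtermap f F \<noteq> bot" using assms(1) by (simp add: filtermap_bot_iff)
  ultimately obtain l where "filtermap f F \<le> nhds l"
    using complete_UNIV[unfolded complete_uniform, rule_format, of "filtermap f F"] by auto
  then show ?thesis unfolding filterlim_def by blast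
qed

text \<open>The averages of \<open>f\<close> eventually stay within \<open>e / 2\<close> of the mean
  of \<open>g\<close>, hence are Cauchy. The error is measured by a dominating function
  \<open>h\<close> with a mean, because the mean of \<open>norm (f x - g x)\<close> is not known to
  exist.\<close>

lemma has_mean_approx:
  fixes f :: "real \<Rightarrow> 'a::{banach,second_countable_topology}"
  assumes f: "\<And>L. set_integrable lebesgue {-L..L} f"
    and approx: "\<And>e. 0 < e \<Longrightarrow> \<exists>g h m m'. has_mean g m \<and> has_mean h m' \<and> m' < e \<and> (\<forall>x. norm (f x - g x) \<le> h x)"
  shows "\<exists>m. has_mean f m"
proof -
  let ?M = "\<lambda>f L. (LINT x:{-L..L}|lebesgue. f x) /\<^sub>R (2 * L)"
  have "\<exists>l. (?M f \<longlongrightarrow> l) at_top"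
  proof (rule Cauchy_net_convergent)
    fix e :: real assume "0 < e"
    then obtain g h m m' where g: "has_mean g m" and h: "has_mean h m'" and m': "m' < e / 4"
      and le: "\<And>x. norm (f x - g x) \<le> h x" using approx[of "e / 4"] by auto
    have "\<forall>\<^sub>F L in at_top. dist (?M g L) m < e / 4"
      using g \<open>0 < e\<close> unfolding has_mean_def by (intro tendstoD) auto
    moreover have "\<forall>\<^sub>F L in at_top. ?M h L < e / 4"
      using h m' unfolding has_mean_def by (intro order_tendstoD(2)) auto
    ultimately have "\<forall>\<^sub>F L in at_top. dist (?M f L) m < e / 2"
      using eventually_gt_at_top[of 0]
    proof eventually_elim
      case (elim L)
      have gi: "set_integrable lebesgue {-L..L} g" and hi: "set_integrable lebesgue {-L..L} h"
        using g h unfolding has_mean_def by auto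
      have "norm ((LINT x:{-L..L}|lebesgue. f x) - (LINT x:{-L..L}|lebesgue. g x))
          = norm (LINT x:{-L..L}|lebesgue. f x - g x)"
        using set_integral_diff(2)[OF f gi] by simp
      also have "\<dots> \<le> (LINT x:{-L..L}|lebesgue. norm (f x - g x))"
        by (intro set_integral_norm_bound set_integral_diff f gi)
      also have "\<dots> \<le> (LINT x:{-L..L}|lebesgue. h x)"
        by (intro set_integral_mono set_integrable_norm set_integral_diff f gi hi le)
      finally have "norm (?M f L - ?M g L) \<le> ?M h L"
        unfolding scaleR_diff_right[symmetric] norm_scaleR using elim(3) by (simp add: mult_left_mono)
      then show ?case using elim dist_triangle[of "?M f L" m "?M g L"] by (simp add: dist_norm)
    qed
    then show "\<exists>P. eventually P at_top \<and> (\<forall>x y. P x \<and> P y \<longrightarrow> dist (?M f x) (?M f y) < e)"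
      by (intro exI[of _ "\<lambda>L. dist (?M f L) m < e / 2"]) (auto intro: dist_triangle_half_l)
  qed simp
  then show ?thesis using f unfolding has_mean_def by blast
qed

lemma has_mean_const: "has_mean (\<lambda>x. c) (c :: real)"
  using has_mean_cmult[OF has_mean_bounded_linear[OF bounded_linear_Re has_mean_exp[of 0]], of c] by simp

text \<open>Parseval's identity for finite sums: the off-diagonal products have mean 0.\<close>

lemma has_mean_exp_sum_norm_square:
  assumes "finite S"
  shows "has_mean (\<lambda>x. (cmod (\<Sum>\<xi>\<in>S. a \<xi> * exp (\<i> * complex_of_real (\<xi> * x))))\<^sup>2) (\<Sum>\<xi>\<in>S. (cmod (a \<xi>))\<^sup>2)"
proof -
  let ?q = "\<lambda>x. \<Sum>\<xi>\<in>S. a \<xi> * exp (\<i> * complex_of_real (\<xi> * x))"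
  have "has_mean (\<lambda>x. Re (\<Sum>\<xi>\<in>S. \<Sum>\<eta>\<in>S. a \<xi> * cnj (a \<eta>) * exp (\<i> * complex_of_real ((\<xi> - \<eta>) * x))))
    (Re (\<Sum>\<xi>\<in>S. \<Sum>\<eta>\<in>S. a \<xi> * cnj (a \<eta>) * (if \<xi> - \<eta> = 0 then 1 else 0)))"
    by (intro has_mean_bounded_linear[OF bounded_linear_Re] has_mean_sum has_mean_cmult has_mean_exp)
  also have "(\<Sum>\<xi>\<in>S. \<Sum>\<eta>\<in>S. a \<xi> * cnj (a \<eta>) * (if \<xi> - \<eta> = 0 then 1 else 0)) = (\<Sum>\<xi>\<in>S. complex_of_real ((cmod (a \<xi>))\<^sup>2))"
    using assms by (intro sum.cong refl) (simp add: complex_norm_square[symmetric] if_distrib cong: if_cong)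
  also have "Re \<dots> = (\<Sum>\<xi>\<in>S. (cmod (a \<xi>))\<^sup>2)" by (simp only: of_real_sum[symmetric] Re_complex_of_real)
  also have "(\<lambda>x. Re (\<Sum>\<xi>\<in>S. \<Sum>\<eta>\<in>S. a \<xi> * cnj (a \<eta>) * exp (\<i> * complex_of_real ((\<xi> - \<eta>) * x)))) = (\<lambda>x. (cmod (?q x))\<^sup>2)"
  proof
    fix x
    have "complex_of_real ((cmod (?q x))\<^sup>2) = ?q x * cnj (?q x)" by (rule complex_norm_square)
    also have "\<dots> = (\<Sum>\<xi>\<in>S. \<Sum>\<eta>\<in>S. a \<xi> * cnj (a \<eta>) * exp (\<i> * complex_of_real ((\<xi> - \<eta>) * x)))"
      unfolding cnj_sum sum_product
      by (intro sum.cong refl) (simp add: exp_cnj exp_add[symmetric] algebra_simps)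
    finally show "Re (\<Sum>\<xi>\<in>S. \<Sum>\<eta>\<in>S. a \<xi> * cnj (a \<eta>) * exp (\<i> * complex_of_real ((\<xi> - \<eta>) * x))) = (cmod (?q x))\<^sup>2"
      by (metis Re_complex_of_real)
  qed
  finally show ?thesis .
qed

lemma trig_poly_means:
  assumes "trig_poly p"
  shows "\<exists>m. has_mean (\<lambda>x. (cmod (p x))\<^sup>2) m"
    and "\<exists>m. has_mean (\<lambda>x. p x * exp (- \<i> * complex_of_real (\<xi> * x))) m"
    and "continuous_on UNIV p"
proof -
  obtain S a where S: "finite S" and p: "p = (\<lambda>x. \<Sum>\<xi>\<in>S. a \<xi> * exp (\<i> * complex_of_real (\<xi> * x)))"
    using assms unfolding trig_poly_def by auto
  show "\<exists>m. has_mean (\<lambda>x. (cmod (p x))\<^sup>2) m" unfolding p using has_mean_exp_sum_norm_square[OF S] by blast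
  have "has_mean (\<lambda>x. \<Sum>\<eta>\<in>S. a \<eta> * exp (\<i> * complex_of_real ((\<eta> - \<xi>) * x)))
    (\<Sum>\<eta>\<in>S. a \<eta> * (if \<eta> - \<xi> = 0 then 1 else 0))"
    by (intro has_mean_sum has_mean_cmult has_mean_exp)
  also have "(\<lambda>x. \<Sum>\<eta>\<in>S. a \<eta> * exp (\<i> * complex_of_real ((\<eta> - \<xi>) * x))) = (\<lambda>x. p x * exp (- \<i> * complex_of_real (\<xi> * x)))"
    unfolding p sum_distrib_right mult.assoc exp_i_of_real_diff by (simp add: left_diff_distrib)
  finally show "\<exists>m. has_mean (\<lambda>x. p x * exp (- \<i> * complex_of_real (\<xi> * x))) m" by blast
  show "continuous_on UNIV p" unfolding p by (intro continuous_intros)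
qed

lemma borel_measurable_lebesgue_continuous:
  fixes f :: "'a::euclidean_space \<Rightarrow> 'b::topological_space"
  assumes "continuous_on UNIV f"
  shows "f \<in> borel_measurable lebesgue"
  using borel_measurable_continuous_onI[OF assms] by (intro measurable_completion) simp

lemma cmod_diff_square: "(cmod (a - b))\<^sup>2 = (cmod a)\<^sup>2 + (- 2 * Re (a * cnj b) + (cmod b)\<^sup>2)"
  unfolding cmod_power2 by (simp add: power2_eq_square algebra_simps)

text \<open>Turns the approximation in \<open>besicovitch2\<close> into a statement on means of
  squares. Square integrability of the difference comes from that of \<open>u\<close> and continuity
  of \<open>p\<close>; the threshold \<open>sqrt e\<close> becomes \<open>e\<close> on
  squaring.\<close>

lemma besicovitch2_approx:
  assumes u: "u \<in> besicovitch2" and "0 < e"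
  shows "\<exists>p l. trig_poly p \<and> has_mean (\<lambda>x. (cmod (u x - p x))\<^sup>2) l \<and> l < e"
proof -
  have "0 < sqrt e" using \<open>0 < e\<close> by simp
  then obtain p l where p: "trig_poly p" and l: "(lp_mean 2 (\<lambda>x. u x - p x) \<longlongrightarrow> l) at_top"
    and lt: "besicovitch_norm 2 (\<lambda>x. u x - p x) < sqrt e"
    using u unfolding besicovitch2_def by blast
  have um: "u \<in> borel_measurable lebesgue" and ui: "set_integrable lebesgue {-L..L} (\<lambda>x. (cmod (u x))\<^sup>2)" for L
    using u unfolding besicovitch2_def by auto
  have pc: "continuous_on UNIV p" using trig_poly_means(3)[OF p] .
  then have pm: "p \<in> borel_measurable lebesgue" by (rule borel_measurable_lebesgue_continuous)
  have int: "set_integrable lebesgue {-L..L} (\<lambda>x. (cmod (u x - p x))\<^sup>2)" for L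
  proof (rule set_integrable_bound)
    show "set_integrable lebesgue {-L..L} (\<lambda>x. 2 * (cmod (u x))\<^sup>2 + 2 * (cmod (p x))\<^sup>2)"
      using pc by (intro set_integral_add set_integrable_mult_right ui set_integrable_lebesgue_continuous continuous_intros)
    have "(cmod (u x - p x))\<^sup>2 \<le> 2 * (cmod (u x))\<^sup>2 + 2 * (cmod (p x))\<^sup>2" for x
    proof -
      have "(cmod (u x - p x))\<^sup>2 \<le> (cmod (u x) + cmod (p x))\<^sup>2" by (intro power_mono norm_triangle_ineq4) simp
      also have "\<dots> \<le> 2 * (cmod (u x))\<^sup>2 + 2 * (cmod (p x))\<^sup>2"
        using sum_squares_bound[of "cmod (u x)" "cmod (p x)"] by (simp add: power2_sum)
      finally show ?thesis .
    qed
    then show "AE x in lebesgue. x \<in> {-L..L} \<longrightarrow> norm ((cmod (u x - p x))\<^sup>2) \<le> norm (2 * (cmod (u x))\<^sup>2 + 2 * (cmod (p x))\<^sup>2)"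
      by (intro AE_I2) (auto simp: abs_of_nonneg)
    show "set_borel_measurable lebesgue {-L..L} (\<lambda>x. (cmod (u x - p x))\<^sup>2)"
      unfolding set_borel_measurable_def
      by (intro borel_measurable_scaleR borel_measurable_indicator borel_measurable_power
          measurable_compose[OF _ borel_measurable_norm] borel_measurable_diff um pm) simp
  qed
  have sq: "cmod z powr 2 = (cmod z)\<^sup>2" for z by (cases "cmod z = 0") (auto simp: powr_realpow[of _ 2, simplified])
  have hm: "has_mean (\<lambda>x. (cmod (u x - p x))\<^sup>2) l"
    using int l unfolding has_mean_def lp_mean_def[abs_def] sq by (simp add: field_simps)
  have "(besicovitch_norm 2 (\<lambda>x. u x - p x))\<^sup>2 = l" "0 \<le> l" using besicovitch_norm_power[OF hm] by auto
  moreover have "(besicovitch_norm 2 (\<lambda>x. u x - p x))\<^sup>2 < (sqrt e)\<^sup>2"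
    using lt by (intro power_strict_mono besicovitch_norm_nonneg) auto
  ultimately show ?thesis using p hm \<open>0 < e\<close> by auto
qed

text \<open>The limit defining \<open>bohr_coeff\<close> has to be shown to exist. Pointwise
  \<open>\<bar>z\<bar> \<le> e / 2 + \<bar>z\<bar>\<^sup>2 / (2 * e)\<close> reduces an error of
  first order to one in mean square, and a squared error below \<open>e\<^sup>2\<close> then gives a
  mean below \<open>e\<close>.\<close>

lemma besicovitch2_bohr_coeff:
  assumes u: "u \<in> besicovitch2"
  shows "has_mean (\<lambda>x. u x * exp (- \<i> * complex_of_real (\<xi> * x))) (bohr_coeff u \<xi>)"
proof -
  let ?E = "\<lambda>x. exp (- \<i> * complex_of_real (\<xi> * x))"
  have um: "u \<in> borel_measurable lebesgue" and ui: "set_integrable lebesgue {-L..L} (\<lambda>x. (cmod (u x))\<^sup>2)" for L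
    using u unfolding besicovitch2_def by auto
  have Em: "?E \<in> borel_measurable lebesgue"
    by (intro borel_measurable_lebesgue_continuous continuous_intros)
  have [simp]: "cmod (?E x) = 1" for x by simp
  have "\<exists>m. has_mean (\<lambda>x. u x * ?E x) m"
  proof (rule has_mean_approx)
    fix L
    show "set_integrable lebesgue {-L..L} (\<lambda>x. u x * ?E x)"
    proof (rule set_integrable_bound)
      show "set_integrable lebesgue {-L..L} (\<lambda>x. 1 + (cmod (u x))\<^sup>2)"
        by (intro set_integral_add ui set_integrable_lebesgue_continuous continuous_intros)
      have "cmod z \<le> 1 + (cmod z)\<^sup>2" for z
        using sum_squares_bound[of "cmod z" 1] norm_ge_zero[of z] by (simp del: norm_ge_zero)
      then show "AE x in lebesgue. x \<in> {-L..L} \<longrightarrow> norm (u x * ?E x) \<le> norm (1 + (cmod (u x))\<^sup>2)"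
        by (intro AE_I2) (simp add: norm_mult)
      show "set_borel_measurable lebesgue {-L..L} (\<lambda>x. u x * ?E x)"
        unfolding set_borel_measurable_def
        by (intro borel_measurable_scaleR borel_measurable_indicator borel_measurable_times um Em) simp
    qed
  next
    fix e :: real assume e: "0 < e"
    obtain p l where p: "trig_poly p" and l: "has_mean (\<lambda>x. (cmod (u x - p x))\<^sup>2) l" "l < e\<^sup>2"
      using besicovitch2_approx[OF u, of "e\<^sup>2"] e by auto
    obtain m where m: "has_mean (\<lambda>x. p x * ?E x) m" using trig_poly_means(2)[OF p] by blast
    have "has_mean (\<lambda>x. e / 2 + 1 / (2 * e) * (cmod (u x - p x))\<^sup>2) (e / 2 + 1 / (2 * e) * l)"
      by (intro has_mean_add has_mean_const has_mean_cmult l)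
    moreover have "e / 2 + 1 / (2 * e) * l < e"
      using l(2) e by (simp add: field_simps power2_eq_square)
    moreover have "cmod (u x * ?E x - p x * ?E x) \<le> e / 2 + 1 / (2 * e) * (cmod (u x - p x))\<^sup>2" for x
    proof -
      have "cmod (u x * ?E x - p x * ?E x) = cmod (u x - p x)"
        unfolding left_diff_distrib[symmetric] norm_mult by simp
      moreover have "2 * e * cmod (u x - p x) \<le> e\<^sup>2 + (cmod (u x - p x))\<^sup>2" by (rule sum_squares_bound)
      ultimately show ?thesis using e by (simp add: field_simps power2_eq_square)
    qed
    ultimately show "\<exists>g h m m'. has_mean g m \<and> has_mean h m' \<and> m' < e \<and> (\<forall>x. norm (u x * ?E x - g x) \<le> h x)"
      using m by blast
  qed
  then show ?thesis using bohr_coeff_eqI by blast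
qed

text \<open>The squares of \<open>u\<close> and of an approximant \<open>p\<close> differ by at most
  \<open>r * (r + 2 * cmod (p x))\<close> with \<open>r = cmod (u x - p x)\<close>. Young's
  inequality with a small parameter \<open>d\<close> separates the product, leaving a large multiple
  of \<open>r\<^sup>2\<close> and a small multiple of a fixed function.\<close>

lemma besicovitch2_norm:
  assumes u: "u \<in> besicovitch2"
  shows "has_mean (\<lambda>x. (cmod (u x))\<^sup>2) ((besicovitch_norm 2 u)\<^sup>2)"
proof -
  have ui: "set_integrable lebesgue {-L..L} (\<lambda>x. (cmod (u x))\<^sup>2)" for L
    using u unfolding besicovitch2_def by auto
  have tri: "(cmod a)\<^sup>2 \<le> 2 * (cmod b)\<^sup>2 + 2 * (cmod (a - b))\<^sup>2" for a b
  proof -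
    have "(cmod a)\<^sup>2 \<le> (cmod b + cmod (a - b))\<^sup>2" using norm_triangle_sub by (intro power_mono) auto
    also have "\<dots> \<le> 2 * (cmod b)\<^sup>2 + 2 * (cmod (a - b))\<^sup>2"
      using sum_squares_bound[of "cmod b" "cmod (a - b)"] by (simp add: power2_sum)
    finally show ?thesis .
  qed
  \<comment> \<open>A fixed approximant dominates the square of \<open>u\<close> by functions with
    known means before the square of \<open>u\<close> is known to have one.\<close>
  obtain p0 l0 where p0: "trig_poly p0" and l0: "has_mean (\<lambda>x. (cmod (u x - p0 x))\<^sup>2) l0"
    using besicovitch2_approx[OF u, of 1] by auto
  obtain m0 where m0: "has_mean (\<lambda>x. (cmod (p0 x))\<^sup>2) m0" using trig_poly_means(1)[OF p0] by blast
  have nn: "0 \<le> l0" "0 \<le> m0" using has_mean_le[OF has_mean_0 l0] has_mean_le[OF has_mean_0 m0] by auto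
  have "\<exists>m. has_mean (\<lambda>x. (cmod (u x))\<^sup>2) m"
  proof (rule has_mean_approx)
    fix e :: real assume e: "0 < e"
    define B where "B = 4 * m0 + 4 * l0 + 1"
    have B: "0 < B" using nn by (simp add: B_def)
    define d where "d = e / (2 * B)"
    have d: "0 < d" using e B by (simp add: d_def)
    \<comment> \<open>\<open>D\<close> collects the coefficients of \<open>r\<^sup>2\<close>: 1 from
      \<open>r * r\<close>, \<open>1 / d\<close> from Young's inequality, and \<open>2 * d\<close>
      from bounding the square of \<open>p\<close> by those of \<open>u\<close> and of the
      error.\<close>
    define D where "D = 1 + 1 / d + 2 * d"
    have D: "0 < D" using d by (simp add: D_def add_pos_pos)
    obtain p l where p: "trig_poly p" and l: "has_mean (\<lambda>x. (cmod (u x - p x))\<^sup>2) l" "l < e / (2 * D)"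
      using besicovitch2_approx[OF u, of "e / (2 * D)"] e D by auto
    obtain m where m: "has_mean (\<lambda>x. (cmod (p x))\<^sup>2) m" using trig_poly_means(1)[OF p] by blast
    have "has_mean (\<lambda>x. D * (cmod (u x - p x))\<^sup>2 + d * (4 * (cmod (p0 x))\<^sup>2 + 4 * (cmod (u x - p0 x))\<^sup>2))
       (D * l + d * (4 * m0 + 4 * l0))"
      by (intro has_mean_add has_mean_cmult l m0 l0)
    moreover have "D * l + d * (4 * m0 + 4 * l0) < e"
    proof -
      have "D * l < e / 2" using l(2) D by (simp add: field_simps)
      moreover have "d * (4 * m0 + 4 * l0) \<le> d * B" using d by (intro mult_left_mono) (auto simp: B_def)
      moreover have "d * B = e / 2" using B by (simp add: d_def)
      ultimately show ?thesis by linarith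
    qed
    moreover have "norm ((cmod (u x))\<^sup>2 - (cmod (p x))\<^sup>2)
       \<le> D * (cmod (u x - p x))\<^sup>2 + d * (4 * (cmod (p0 x))\<^sup>2 + 4 * (cmod (u x - p0 x))\<^sup>2)" for x
    proof -
      let ?r = "cmod (u x - p x)" and ?b = "cmod (p x)"
      have "\<bar>(cmod (u x))\<^sup>2 - ?b\<^sup>2\<bar> = \<bar>cmod (u x) - ?b\<bar> * (cmod (u x) + ?b)"
        by (simp add: power2_eq_square square_diff_square_factored abs_mult mult.commute)
      also have "\<dots> \<le> ?r * (?r + 2 * ?b)"
        using norm_triangle_ineq3[of "u x" "p x"] norm_triangle_sub[of "u x" "p x"] by (intro mult_mono) auto
      also have "\<dots> \<le> ?r\<^sup>2 + (1 / d * ?r\<^sup>2 + d * ?b\<^sup>2)"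
      proof -
        have "0 \<le> (?r - d * ?b)\<^sup>2 / d" using d by simp
        also have "\<dots> = 1 / d * ?r\<^sup>2 + d * ?b\<^sup>2 - 2 * ?r * ?b"
          using d by (simp add: power2_eq_square field_simps)
        finally show ?thesis by (simp add: power2_eq_square algebra_simps)
      qed
      also have "?b\<^sup>2 \<le> 2 * (cmod (u x))\<^sup>2 + 2 * ?r\<^sup>2" using tri[of "p x" "u x"] by (simp add: norm_minus_commute)
      also have "(cmod (u x))\<^sup>2 \<le> 2 * (cmod (p0 x))\<^sup>2 + 2 * (cmod (u x - p0 x))\<^sup>2" by (rule tri)
      finally show ?thesis using d by (simp add: D_def algebra_simps)
    qed
    ultimately show "\<exists>g h m m'. has_mean g m \<and> has_mean h m' \<and> m' < e \<and> (\<forall>x. norm ((cmod (u x))\<^sup>2 - g x) \<le> h x)"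
      using m by blast
  qed (rule ui)
  then obtain m where m: "has_mean (\<lambda>x. (cmod (u x))\<^sup>2) m" by blast
  then show ?thesis using besicovitch_norm_power(1)[OF m] by simp
qed

text \<open>The square of \<open>u - q\<close>, with \<open>q\<close> the Fourier sum over
  \<open>X\<close>, has a nonnegative mean. Expanded, that mean is the squared norm of
  \<open>u\<close> minus twice plus once the sum of squared coefficients.\<close>

lemma bessel_inequality:
  assumes u: "u \<in> besicovitch2" and "finite X"
  shows "(\<Sum>\<xi>\<in>X. (cmod (bohr_coeff u \<xi>))\<^sup>2) \<le> (besicovitch_norm 2 u)\<^sup>2"
proof -
  let ?a = "bohr_coeff u"
  let ?q = "\<lambda>x. \<Sum>\<xi>\<in>X. ?a \<xi> * exp (\<i> * complex_of_real (\<xi> * x))"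
  let ?r = "\<lambda>x. \<Sum>\<xi>\<in>X. cnj (?a \<xi>) * (u x * exp (- \<i> * complex_of_real (\<xi> * x)))"
  let ?s = "\<Sum>\<xi>\<in>X. (cmod (?a \<xi>))\<^sup>2"
  have "has_mean (\<lambda>x. Re (?r x)) (Re (\<Sum>\<xi>\<in>X. cnj (?a \<xi>) * ?a \<xi>))"
    by (intro has_mean_bounded_linear[OF bounded_linear_Re] has_mean_sum has_mean_cmult besicovitch2_bohr_coeff u)
  also have "(\<Sum>\<xi>\<in>X. cnj (?a \<xi>) * ?a \<xi>) = complex_of_real ?s"
    unfolding of_real_sum complex_norm_square by (intro sum.cong refl mult.commute)
  finally have r: "has_mean (\<lambda>x. Re (?r x)) ?s" by (simp only: Re_complex_of_real)
  have mean: "has_mean (\<lambda>x. (cmod (u x))\<^sup>2 + (- 2 * Re (?r x) + (cmod (?q x))\<^sup>2)) ((besicovitch_norm 2 u)\<^sup>2 + (- 2 * ?s + ?s))"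
    by (intro has_mean_add has_mean_cmult r besicovitch2_norm u has_mean_exp_sum_norm_square assms)
  have "0 \<le> (cmod (u x))\<^sup>2 + (- 2 * Re (?r x) + (cmod (?q x))\<^sup>2)" for x
  proof -
    have "?r x = u x * cnj (?q x)"
      unfolding cnj_sum sum_distrib_left by (intro sum.cong refl) (simp add: exp_cnj)
    then have "(cmod (u x - ?q x))\<^sup>2 = (cmod (u x))\<^sup>2 + (- 2 * Re (?r x) + (cmod (?q x))\<^sup>2)"
      by (simp only: cmod_diff_square)
    then show ?thesis by (metis zero_le_power2)
  qed
  then have "0 \<le> (besicovitch_norm 2 u)\<^sup>2 + (- 2 * ?s + ?s)" by (rule has_mean_le[OF has_mean_0 mean])
  then show ?thesis by simp
qed

section \<open>Estimates for lattice evolutions\<close>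

text \<open>The shape \<open>R * Q\<^sup>2\<close> is that of the quartic bounds, where
  \<open>Q\<close> is already a squared weighted norm of the coefficients.\<close>

lemma le_powr_quarter:
  fixes y R Q :: real
  assumes "y ^ 4 \<le> R * Q\<^sup>2" "0 \<le> R" "0 \<le> Q"
  shows "y \<le> R powr (1 / 4) * sqrt Q"
proof (rule power_le_imp_le_base)
  have "(R powr (1 / 4)) ^ 4 = R"
    using assms(2) powr_realpow[of "R powr (1 / 4)" 4] by (cases "R = 0") (auto simp: powr_powr)
  moreover have "sqrt Q ^ 4 = Q\<^sup>2"
    using power_mult[of "sqrt Q" 2 2] assms(3) by simp
  ultimately show "y ^ Suc 3 \<le> (R powr (1 / 4) * sqrt Q) ^ Suc 3"
    using assms(1) unfolding power_mult_distrib by simp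
qed (use assms in simp)

text \<open>Common form of the quadratic and cubic cases: the dispersion relation enters only
  through the lower bound on the phase difference, with \<open>E = 1 / 2\<close> for the former and
  \<open>E = 3 / 4 * N\<close> for the latter.\<close>

lemma LINT_quadratic_phase_le:
  fixes \<omega> :: "real ^ 'n" and S :: "(int ^ 'n) set"
  assumes fin: "finite S" and T: "0 < T" and inj: "inj (freq \<omega>)"
    and v: "\<And>n. n \<in> S \<Longrightarrow> 0 < v n" and vg: "\<And>n. n \<in> S \<Longrightarrow> (v n)\<^sup>2 \<le> (\<Prod>i\<in>-{j}. g (n $ i))"
    and g0: "\<And>k. 0 \<le> g k" and G: "\<And>K. finite K \<Longrightarrow> (\<Sum>k\<in>K. g k) \<le> G"
    and \<omega>: "0 < \<omega> $ j" and E: "0 < E"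
    and ph: "\<And>m n k l. m \<in> S \<Longrightarrow> n \<in> S \<Longrightarrow> k \<in> S \<Longrightarrow> l \<in> S \<Longrightarrow> freq \<omega> k + freq \<omega> l = freq \<omega> m + freq \<omega> n \<Longrightarrow>
        E * \<bar>(freq \<omega> m - freq \<omega> n)\<^sup>2 - (freq \<omega> k - freq \<omega> l)\<^sup>2\<bar> \<le> \<bar>\<phi> m + \<phi> n - (\<phi> k + \<phi> l)\<bar>"
  shows "(LINT t:{0..T}|lebesgue. besicovitch_norm 4 (evolution S c (freq \<omega>) \<phi> t) ^ 4)
    \<le> 6 * T * G ^ (CARD('n) - 1) * (1 + pi / (sqrt (T * E) * \<omega> $ j)) * (\<Sum>n\<in>S. (cmod (c n))\<^sup>2 / v n)\<^sup>2"
proof -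
  let ?D = "sqrt (T * E)"
  have TE: "0 < T * E" using T E by simp
  have "(LINT t:{0..T}|lebesgue. besicovitch_norm 4 (evolution S c (freq \<omega>) \<phi> t) ^ 4)
    \<le> 6 * 1 * T * G ^ (CARD('n) - 1) * (1 + 2 * pi / (2 * ?D * \<omega> $ j)) * (\<Sum>n\<in>S. (cmod (c n))\<^sup>2 / v n)\<^sup>2"
  proof (rule LINT_lattice_evolution_le[OF fin T inj v vg g0 G])
    show "0 < 2 * ?D" using TE by simp
    fix m n assume mn: "m \<in> S" "n \<in> S"
    let ?M = "freq \<omega> m + freq \<omega> n" and ?x = "freq \<omega> m - freq \<omega> n"
    have "1 / (1 + T * \<bar>\<phi> m + \<phi> n - (\<phi> k + \<phi> l)\<bar>)
        \<le> 1 / (1 + (2 * ?D * freq \<omega> k + ?D * (- ?M - ?x))\<^sup>2) + 1 / (1 + (2 * ?D * freq \<omega> k + ?D * (- ?M + ?x))\<^sup>2)"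
      if kl: "k \<in> S" "l \<in> S" "freq \<omega> k + freq \<omega> l = ?M" for k l
    proof -
      let ?y = "freq \<omega> k - freq \<omega> l"
      have "T * E * \<bar>?x\<^sup>2 - ?y\<^sup>2\<bar> \<le> T * \<bar>\<phi> m + \<phi> n - (\<phi> k + \<phi> l)\<bar>"
        using mult_left_mono[OF ph[OF mn kl], of T] T by (simp add: mult.assoc)
      then have "1 / (1 + T * \<bar>\<phi> m + \<phi> n - (\<phi> k + \<phi> l)\<bar>) \<le> 1 / (1 + T * E * \<bar>?x\<^sup>2 - ?y\<^sup>2\<bar>)"
        using T E TE by (intro divide_left_mono mult_pos_pos) (auto intro!: add_pos_nonneg mult_nonneg_nonneg simp: less_imp_le)
      also have "\<dots> \<le> 1 / (1 + (?D * (?y - ?x))\<^sup>2) + 1 / (1 + (?D * (?y + ?x))\<^sup>2)"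
        by (rule quadratic_phase_le[OF TE])
      \<comment> \<open>The resonance relation eliminates \<open>l\<close>; both Lorentzians become
        functions of \<open>freq \<omega> k\<close> with slope \<open>2 * ?D\<close>.\<close>
      also have "?y = 2 * freq \<omega> k - ?M" using kl(3) by simp
      also have "?D * (2 * freq \<omega> k - ?M - ?x) = 2 * ?D * freq \<omega> k + ?D * (- ?M - ?x)" by (simp add: algebra_simps)
      also have "?D * (2 * freq \<omega> k - ?M + ?x) = 2 * ?D * freq \<omega> k + ?D * (- ?M + ?x)" by (simp add: algebra_simps)
      finally show ?thesis .
    qed
    then show "\<exists>a b. \<forall>k\<in>S. \<forall>l\<in>S. freq \<omega> k + freq \<omega> l = freq \<omega> m + freq \<omega> n \<longrightarrow>
        1 / (1 + T * \<bar>\<phi> m + \<phi> n - (\<phi> k + \<phi> l)\<bar>)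
        \<le> 1 * (1 / (1 + (2 * ?D * freq \<omega> k + a)\<^sup>2) + 1 / (1 + (2 * ?D * freq \<omega> k + b)\<^sup>2))"
      unfolding mult_1 by blast
  qed (use \<omega> in auto)
  then show ?thesis by (simp add: mult.assoc)
qed

text \<open>Nonnegative and negative integers are each folded injectively onto the naturals by
  \<open>nat \<bar>k\<bar>\<close>, where the series converges; hence twice its sum.\<close>

lemma sum_int_powr_le:
  assumes "1 < p"
  obtains G where "\<And>K :: int set. finite K \<Longrightarrow> (\<Sum>k\<in>K. (1 + \<bar>real_of_int k\<bar>) powr - p) \<le> G"
proof
  let ?f = "\<lambda>m::nat. real (Suc m) powr - p"
  have f: "summable ?f"
    using assms summable_Suc_iff[of "\<lambda>n. real n powr - p"] by (simp add: summable_real_powr_iff del: of_nat_Suc)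
  fix K :: "int set" assume K: "finite K"
  let ?h = "\<lambda>k. (1 + \<bar>real_of_int k\<bar>) powr - p"
  have half: "(\<Sum>k\<in>{k\<in>K. P k}. ?h k) \<le> suminf ?f" if "inj_on (\<lambda>k. nat \<bar>k\<bar>) {k. P k}" for P
  proof -
    have inj: "inj_on (\<lambda>k. nat \<bar>k\<bar>) {k\<in>K. P k}" using that by (rule inj_on_subset) auto
    have "(\<Sum>k\<in>{k\<in>K. P k}. ?h k) = (\<Sum>k\<in>{k\<in>K. P k}. ?f (nat \<bar>k\<bar>))"
      by (intro sum.cong refl) (simp add: add.commute)
    also have "\<dots> = (\<Sum>m\<in>(\<lambda>k. nat \<bar>k\<bar>) ` {k\<in>K. P k}. ?f m)" using inj by (simp add: sum.reindex)
    also have "\<dots> \<le> suminf ?f" using K by (intro sum_le_suminf f) auto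
    finally show ?thesis .
  qed
  have "(\<Sum>k\<in>K. ?h k) = (\<Sum>k\<in>{k\<in>K. 0 \<le> k}. ?h k) + (\<Sum>k\<in>{k\<in>K. k < 0}. ?h k)"
    using K by (subst sum.union_disjoint[symmetric]) (auto intro!: sum.cong)
  also have "\<dots> \<le> suminf ?f + suminf ?f"
    by (intro add_mono half) (auto simp: inj_on_def)
  finally show "(\<Sum>k\<in>K. ?h k) \<le> suminf ?f + suminf ?f" .
qed

lemma abs_component_le_norm_lattice_vec: "\<bar>real_of_int (n $ i)\<bar> \<le> norm (lattice_vec n)"
  using component_le_norm_cart[of "lattice_vec n" i] by (simp add: lattice_vec_def)

text \<open>The Schur weight is the inverse of the Sobolev weight. Its square
  \<open>J powr - (4 * s)\<close> has to pay for \<open>b\<close> one-dimensional sums, each needing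
  an exponent above 1, which is the condition \<open>s > b / 4\<close>.\<close>

lemma schroedinger_evolution_le:
  fixes \<omega> :: "real ^ 'n"
  assumes pos: "\<And>i. \<omega> $ i > 0" and nonres: "nonresonant \<omega>" and s: "s > (real CARD('n) - 1) / 4"
  obtains K where "0 < K" "\<And>T S c. 0 < T \<Longrightarrow> T \<le> 1 \<Longrightarrow> finite S \<Longrightarrow>
    l4l4_norm T (evolution S c (freq \<omega>) (\<lambda>n. (freq \<omega> n)\<^sup>2))
      \<le> K * T powr (1 / 8) * sqrt (\<Sum>n\<in>S. jbracket (lattice_vec n) powr (2 * s) * (cmod (c n))\<^sup>2)"
proof -
  define b where "b = real CARD('n) - 1"
  have card: "1 \<le> CARD('n)" by (simp add: Suc_leI)
  have b: "0 \<le> b" "real (CARD('n) - 1) = b" using card by (auto simp: b_def)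
  \<comment> \<open>For positive \<open>b\<close> the exponent is shared equally,
    \<open>p = 4 * s / b\<close>. In dimension one there are no weighted coordinates, so 2 is an
    arbitrary admissible value.\<close>
  have "\<exists>p>1. p * b \<le> 4 * s"
  proof (cases "b = 0")
    case True
    then show ?thesis using s by (intro exI[of _ 2]) (simp add: b_def)
  next
    case False
    then have "0 < b" using b(1) by simp
    moreover have "b < 4 * s" using s by (simp add: b_def)
    ultimately have "1 < 4 * s / b" "4 * s / b * b = 4 * s" by auto
    then show ?thesis by (intro exI[of _ "4 * s / b"]) simp
  qed
  then obtain p where p: "1 < p" "p * b \<le> 4 * s" by blast
  define g where "g k = (1 + \<bar>real_of_int k\<bar>) powr - p" for k
  obtain G where G: "\<And>K :: int set. finite K \<Longrightarrow> (\<Sum>k\<in>K. g k) \<le> G"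
    using sum_int_powr_le[OF p(1)] unfolding g_def by blast
  have G0: "0 \<le> G" using G[of "{}"] by simp
  \<comment> \<open>Types are nonempty, and any coordinate can serve as the freely summed
    one.\<close>
  obtain j :: 'n where True by simp
  define v :: "int ^ 'n \<Rightarrow> real" where "v n = jbracket (lattice_vec n) powr (- 2 * s)" for n
  have J: "1 \<le> jbracket (lattice_vec n)" for n :: "int ^ 'n" by (simp add: jbracket_def)
  have v: "0 < v n" for n using J[of n] by (simp add: v_def)
  have vg: "(v n)\<^sup>2 \<le> (\<Prod>i\<in>-{j}. g (n $ i))" for n
  proof -
    let ?J = "jbracket (lattice_vec n)"
    have "(v n)\<^sup>2 = ?J powr (- (4 * s))" using J[of n] by (simp add: v_def power2_eq_square powr_add[symmetric])
    also have "\<dots> \<le> ?J powr (- (p * b))" using J[of n] p(2) by (intro powr_mono) auto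
    also have "\<dots> = (?J powr - p) ^ (CARD('n) - 1)" using J[of n] b(2) by (simp add: powr_power mult.commute)
    also have "\<dots> = (\<Prod>i\<in>-{j}. ?J powr - p)" by (simp add: Compl_eq_Diff_UNIV)
    \<comment> \<open>Each \<open>1 + \<bar>n $ i\<bar>\<close> is at most the bracket of the whole
      vector, and negative powers reverse the order.\<close>
    also have "\<dots> \<le> (\<Prod>i\<in>-{j}. g (n $ i))"
      unfolding g_def using p(1) J[of n]
      by (intro prod_mono conjI powr_mono2') (auto simp: jbracket_def abs_component_le_norm_lattice_vec)
    finally show ?thesis .
  qed
  define K0 where "K0 = 6 * (G ^ (CARD('n) - 1) * (1 + 2 * pi / \<omega> $ j)) + 1"
  have w: "0 < \<omega> $ j" by (rule pos)
  have K0: "0 < K0" using G0 w unfolding K0_def by (intro add_nonneg_pos mult_nonneg_nonneg) auto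
  show ?thesis
  proof
    show "0 < K0 powr (1 / 4)" using K0 by simp
    fix T :: real and S :: "(int ^ 'n) set" and c :: "int ^ 'n \<Rightarrow> complex"
    assume T: "0 < T" "T \<le> 1" and S: "finite S"
    let ?Q = "\<Sum>n\<in>S. jbracket (lattice_vec n) powr (2 * s) * (cmod (c n))\<^sup>2"
    have Q: "(\<Sum>n\<in>S. (cmod (c n))\<^sup>2 / v n) = ?Q"
      unfolding v_def by (intro sum.cong refl) (simp add: powr_minus field_simps)
    have "l4l4_norm T (evolution S c (freq \<omega>) (\<lambda>n. (freq \<omega> n)\<^sup>2)) ^ 4
      \<le> 6 * T * G ^ (CARD('n) - 1) * (1 + pi / (sqrt (T * (1 / 2)) * \<omega> $ j)) * ?Q\<^sup>2"
      unfolding l4l4_norm_power4 Q[symmetric]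
    proof (rule LINT_quadratic_phase_le[OF S T(1) inj_freq[OF nonres] v vg _ G w])
      show "1 / 2 * \<bar>(freq \<omega> m - freq \<omega> n)\<^sup>2 - (freq \<omega> k - freq \<omega> l)\<^sup>2\<bar>
          \<le> \<bar>(freq \<omega> m)\<^sup>2 + (freq \<omega> n)\<^sup>2 - ((freq \<omega> k)\<^sup>2 + (freq \<omega> l)\<^sup>2)\<bar>"
        if "freq \<omega> k + freq \<omega> l = freq \<omega> m + freq \<omega> n" for m n k l
      proof -
        have l: "freq \<omega> l = freq \<omega> m + freq \<omega> n - freq \<omega> k" using that by simp
        have eq: "(freq \<omega> m)\<^sup>2 + (freq \<omega> n)\<^sup>2 - ((freq \<omega> k)\<^sup>2 + (freq \<omega> l)\<^sup>2)
            = 1 / 2 * ((freq \<omega> m - freq \<omega> n)\<^sup>2 - (freq \<omega> k - freq \<omega> l)\<^sup>2)"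
          unfolding l by (simp add: power2_eq_square field_simps)
        show ?thesis unfolding eq abs_mult by simp
      qed
    qed (auto simp: g_def)
    also have "\<dots> \<le> K0 * sqrt T * ?Q\<^sup>2"
    proof (rule mult_right_mono)
      \<comment> \<open>The factor \<open>T\<close> meets \<open>1 / sqrt T\<close> from the
        Lorentzian sum, leaving \<open>sqrt T\<close> and after the fourth root
        \<open>T powr (1 / 8)\<close>. The summand 1 is absorbed into \<open>1 / sqrt T\<close> by
        \<open>T \<le> 1\<close>.\<close>
      have sT: "0 < sqrt T" "sqrt T \<le> 1" "sqrt T * sqrt T = T" using T by auto
      have "sqrt T / 2 \<le> sqrt (T * (1 / 2))"
        using T by (intro real_le_rsqrt) (simp add: power_divide)
      then have "pi / (sqrt (T * (1 / 2)) * \<omega> $ j) \<le> pi / (sqrt T / 2 * \<omega> $ j)"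
        using sT w by (intro divide_left_mono mult_right_mono mult_pos_pos) auto
      also have "\<dots> = (2 * pi / \<omega> $ j) / sqrt T" by (simp add: mult.commute)
      finally have "1 + pi / (sqrt (T * (1 / 2)) * \<omega> $ j) \<le> 1 / sqrt T + (2 * pi / \<omega> $ j) / sqrt T"
        using sT by (intro add_mono) auto
      also have "\<dots> = (1 + 2 * pi / \<omega> $ j) / sqrt T" by (simp add: add_divide_distrib)
      finally have "6 * T * G ^ (CARD('n) - 1) * (1 + pi / (sqrt (T * (1 / 2)) * \<omega> $ j))
          \<le> 6 * T * G ^ (CARD('n) - 1) * ((1 + 2 * pi / \<omega> $ j) / sqrt T)"
        using T G0 by (intro mult_left_mono) auto
      also have "\<dots> = 6 * (G ^ (CARD('n) - 1) * (1 + 2 * pi / \<omega> $ j)) * (T / sqrt T)" by simp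
      also have "T / sqrt T = sqrt T" using T by (rule_tac real_div_sqrt) simp
      also have "6 * (G ^ (CARD('n) - 1) * (1 + 2 * pi / \<omega> $ j)) * sqrt T \<le> K0 * sqrt T"
        using T unfolding K0_def by (intro mult_right_mono) auto
      finally show "6 * T * G ^ (CARD('n) - 1) * (1 + pi / (sqrt (T * (1 / 2)) * \<omega> $ j)) \<le> K0 * sqrt T" .
    qed simp
    finally have "l4l4_norm T (evolution S c (freq \<omega>) (\<lambda>n. (freq \<omega> n)\<^sup>2)) \<le> (K0 * sqrt T) powr (1 / 4) * sqrt ?Q"
      using K0 T by (intro le_powr_quarter) (auto intro!: sum_nonneg)
    also have "(K0 * sqrt T) powr (1 / 4) = K0 powr (1 / 4) * T powr (1 / 8)"
      using K0 T by (simp add: powr_mult powr_powr powr_half_sqrt[symmetric])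
    finally show "l4l4_norm T (evolution S c (freq \<omega>) (\<lambda>n. (freq \<omega> n)\<^sup>2)) \<le> K0 powr (1 / 4) * T powr (1 / 8) * sqrt ?Q" .
  qed
qed

section \<open>Reduction to finite lattice sums\<close>

text \<open>The propagators sum over the spectrum, evolutions over indices. Injectivity of
  \<open>\<mu>\<close> matches the two, and indices with zero coefficient are added back at no
  cost.\<close>

lemma sum_exp_reindex_spectrum:
  assumes "finite S" "inj \<mu>"
  shows "(\<Sum>\<xi>\<in>spectrum (\<lambda>x. \<Sum>n\<in>S. c n * exp (\<i> * complex_of_real (\<mu> n * x))).
      bohr_coeff (\<lambda>x. \<Sum>n\<in>S. c n * exp (\<i> * complex_of_real (\<mu> n * x))) \<xi> * exp (\<i> * complex_of_real (\<xi> * x - t * \<psi> \<xi>)))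
    = evolution S c \<mu> (\<lambda>n. \<psi> (\<mu> n)) t x"
proof -
  let ?f = "\<lambda>x. \<Sum>n\<in>S. c n * exp (\<i> * complex_of_real (\<mu> n * x))"
  let ?e = "\<lambda>\<xi>. exp (\<i> * complex_of_real (\<xi> * x - t * \<psi> \<xi>))"
  let ?Y = "{n\<in>S. c n \<noteq> 0}"
  have inj: "inj_on \<mu> ?Y" using assms(2) by (rule inj_on_subset) simp
  have "(\<Sum>\<xi>\<in>spectrum ?f. bohr_coeff ?f \<xi> * ?e \<xi>) = (\<Sum>n\<in>?Y. bohr_coeff ?f (\<mu> n) * ?e (\<mu> n))"
    unfolding spectrum_exp_sum[OF assms] sum.reindex[OF inj] by (simp only: o_def)
  also have "\<dots> = (\<Sum>n\<in>?Y. c n * ?e (\<mu> n))"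
    by (intro sum.cong refl) (simp only: bohr_coeff_exp_sum_at[OF assms] mem_Collect_eq if_True)
  also have "\<dots> = (\<Sum>n\<in>S. c n * ?e (\<mu> n))" using assms(1) by (intro sum.mono_neutral_left) auto
  finally show ?thesis unfolding evolution_def .
qed

lemma schroedinger_exp_sum:
  assumes "finite S" "inj \<mu>"
  shows "schroedinger t (\<lambda>x. \<Sum>n\<in>S. c n * exp (\<i> * complex_of_real (\<mu> n * x))) = evolution S c \<mu> (\<lambda>n. (\<mu> n)\<^sup>2) t"
  unfolding schroedinger_def sum_exp_reindex_spectrum[OF assms, of c _ t "\<lambda>\<xi>. \<xi>\<^sup>2"] by simp

lemma airy_exp_sum:
  assumes "finite S" "inj \<mu>"
  shows "airy t (\<lambda>x. \<Sum>n\<in>S. c n * exp (\<i> * complex_of_real (\<mu> n * x))) = evolution S c \<mu> (\<lambda>n. (\<mu> n) ^ 3) t"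
  unfolding airy_def sum_exp_reindex_spectrum[OF assms, of c _ t "\<lambda>\<xi>. \<xi> ^ 3"] by simp

text \<open>A representation of \<open>u\<close> may list frequencies outside the module, but with
  zero coefficients, as the spectrum consists of exactly those with nonzero coefficient. These are
  dropped and the rest is pulled back to the lattice.\<close>

lemma trig_poly_lattice_sum:
  assumes "trig_poly u" "spectrum u \<subseteq> freq_module \<omega>" "inj (freq \<omega>)"
  obtains X c where "finite X" "u = (\<lambda>x. \<Sum>n\<in>X. c n * exp (\<i> * complex_of_real (freq \<omega> n * x)))"
proof -
  obtain S a where S: "finite S" and u: "u = (\<lambda>x. \<Sum>\<xi>\<in>S. a \<xi> * exp (\<i> * complex_of_real (\<xi> * x)))"
    using assms(1) unfolding trig_poly_def by auto
  have "spectrum u = {\<xi>\<in>S. a \<xi> \<noteq> 0}"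
    unfolding u using spectrum_exp_sum[OF S, of "\<lambda>x. x" a] by simp
  then have sub: "{\<xi>\<in>S. a \<xi> \<noteq> 0} \<subseteq> range (freq \<omega>)" using assms(2) unfolding freq_module_def by simp
  let ?X = "freq \<omega> -` {\<xi>\<in>S. a \<xi> \<noteq> 0}"
  have X: "finite ?X" using S assms(3) by (intro finite_vimageI) auto
  have im: "freq \<omega> ` ?X = {\<xi>\<in>S. a \<xi> \<noteq> 0}" using sub by auto
  have "u x = (\<Sum>n\<in>?X. a (freq \<omega> n) * exp (\<i> * complex_of_real (freq \<omega> n * x)))" for x
  proof -
    have "u x = (\<Sum>\<xi>\<in>{\<xi>\<in>S. a \<xi> \<noteq> 0}. a \<xi> * exp (\<i> * complex_of_real (\<xi> * x)))"
      unfolding u using S by (intro sum.mono_neutral_right) auto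
    also have "\<dots> = (\<Sum>n\<in>?X. a (freq \<omega> n) * exp (\<i> * complex_of_real (freq \<omega> n * x)))"
      using sum.reindex[OF inj_on_subset[OF assms(3) subset_UNIV], of "\<lambda>\<xi>. a \<xi> * exp (\<i> * complex_of_real (\<xi> * x))" ?X]
      unfolding im by (simp only: o_def)
    finally show ?thesis .
  qed
  then show ?thesis by (intro that[OF X] ext)
qed

lemma sobolev_norm_exp_sum:
  assumes "finite X" "inj (freq \<omega>)"
  shows "sobolev_norm \<omega> s (\<lambda>x. \<Sum>n\<in>X. c n * exp (\<i> * complex_of_real (freq \<omega> n * x)))
    = sqrt (\<Sum>n\<in>X. jbracket (lattice_vec n) powr (2 * s) * (cmod (c n))\<^sup>2)"
proof -
  let ?u = "\<lambda>x. \<Sum>n\<in>X. c n * exp (\<i> * complex_of_real (freq \<omega> n * x))"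
  have "sobolev_term \<omega> s ?u n = (if n \<in> X then jbracket (lattice_vec n) powr (2 * s) * (cmod (c n))\<^sup>2 else 0)" for n
    unfolding sobolev_term_def bohr_coeff_exp_sum_at[OF assms] by simp
  then have "(\<Sum>\<^sub>\<infinity>n. sobolev_term \<omega> s ?u n) = (\<Sum>\<^sub>\<infinity>n\<in>X. jbracket (lattice_vec n) powr (2 * s) * (cmod (c n))\<^sup>2)"
    by (intro infsum_cong_neutral) simp_all
  then show ?thesis unfolding sobolev_norm_def using assms(1) by simp
qed

text \<open>The sums over \<open>F\<close> and over \<open>X \<union> F\<close> are both within
  \<open>e / 2\<close> of the limit, and differ by the sum over \<open>X\<close>.\<close>

lemma summable_on_finite_tail:
  fixes f :: "'a \<Rightarrow> real"
  assumes "f summable_on UNIV" "0 < e"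
  obtains F where "finite F" "\<And>X. finite X \<Longrightarrow> X \<inter> F = {} \<Longrightarrow> (\<Sum>x\<in>X. f x) < e"
proof -
  obtain l where "(f has_sum l) UNIV" using assms(1) by (auto simp: summable_on_def)
  then have "\<forall>\<^sub>F S in finite_subsets_at_top UNIV. dist (sum f S) l < e / 2"
    unfolding has_sum_def using assms(2) by (intro tendstoD) auto
  then obtain F where F: "finite F" and le: "\<And>S. finite S \<Longrightarrow> F \<subseteq> S \<Longrightarrow> dist (sum f S) l < e / 2"
    unfolding eventually_finite_subsets_at_top by auto
  show ?thesis
  proof (rule that[OF F])
    fix X assume X: "finite X" "X \<inter> F = {}"
    have "sum f (X \<union> F) = sum f X + sum f F" using X F by (intro sum.union_disjoint)
    moreover have "dist (sum f F) l < e / 2" "dist (sum f (X \<union> F)) l < e / 2" using le[OF F subset_refl] le[of "X \<union> F"] X F by simp_all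
    ultimately show "sum f X < e" unfolding dist_real_def by linarith
  qed
qed

text \<open>Makes a height projection a finite exponential sum, whatever the spectrum of the
  function.\<close>

lemma finite_lattice_ball: "finite {n :: int ^ 'n. norm (lattice_vec n) \<le> R}"
proof (rule finite_subset)
  let ?A = "Pi\<^sub>E (UNIV :: 'n set) (\<lambda>_. {- \<lceil>R\<rceil>..\<lceil>R\<rceil>})"
  show "{n :: int ^ 'n. norm (lattice_vec n) \<le> R} \<subseteq> (\<lambda>f. \<chi> i. f i) ` ?A"
  proof
    fix n :: "int ^ 'n" assume n: "n \<in> {n. norm (lattice_vec n) \<le> R}"
    have "n $ i \<in> {- \<lceil>R\<rceil>..\<lceil>R\<rceil>}" for i
    proof -
      have "\<bar>real_of_int (n $ i)\<bar> \<le> R" using n abs_component_le_norm_lattice_vec[of n i] by simp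
      then have "real_of_int \<bar>n $ i\<bar> \<le> of_int \<lceil>R\<rceil>" using le_of_int_ceiling[of R] unfolding of_int_abs by linarith
      then have "\<bar>n $ i\<bar> \<le> \<lceil>R\<rceil>" by (simp only: of_int_le_iff)
      then show ?thesis by auto
    qed
    then have "(\<lambda>i. n $ i) \<in> ?A" by (simp only: PiE_UNIV_domain) auto
    moreover have "n = (\<chi> i. n $ i)" by (simp add: vec_eq_iff)
    ultimately show "n \<in> (\<lambda>f. \<chi> i. f i) ` ?A" by blast
  qed
  show "finite ((\<lambda>f. \<chi> i. f i) ` ?A)" by (intro finite_imageI finite_PiE) auto
qed

section \<open>Dyadic cutoffs and the cubic estimate\<close>

text \<open>Nonnegativity is a consequence of radial monotonicity: the value at \<open>\<xi>\<close>
  is at least that at \<open>\<bar>\<xi>\<bar> + 2\<close>, which lies outside the support.\<close>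

lemma cutoff_bounds:
  assumes "cutoff \<theta>"
  shows "0 \<le> \<theta> \<xi>" "\<theta> \<xi> \<le> 1" "\<theta> \<xi> \<noteq> 0 \<Longrightarrow> \<bar>\<xi>\<bar> < 2" "\<bar>\<xi>\<bar> \<le> 1 \<Longrightarrow> \<theta> \<xi> = 1"
    and "\<bar>\<xi>\<bar> \<le> \<bar>\<eta>\<bar> \<Longrightarrow> \<theta> \<eta> \<le> \<theta> \<xi>"
proof -
  have supp: "closure {\<xi>. \<theta> \<xi> \<noteq> 0} \<subseteq> {-2<..<2}"
    and mono: "\<And>\<xi> \<eta>. \<bar>\<xi>\<bar> \<le> \<bar>\<eta>\<bar> \<Longrightarrow> \<theta> \<eta> \<le> \<theta> \<xi>"
    and one: "\<And>\<xi>. \<bar>\<xi>\<bar> \<le> 1 \<Longrightarrow> \<theta> \<xi> = 1"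
    using assms unfolding cutoff_def by auto
  have z: "\<bar>\<xi>\<bar> < 2" if "\<theta> \<xi> \<noteq> 0" for \<xi>
  proof -
    have "\<xi> \<in> closure {\<xi>. \<theta> \<xi> \<noteq> 0}" by (rule closure_subset[THEN subsetD]) (use that in simp)
    then have "\<xi> \<in> {-2<..<2}" using supp by (rule rev_subsetD)
    then show ?thesis by auto
  qed
  have "\<theta> (\<bar>\<xi>\<bar> + 2) = 0" using z[of "\<bar>\<xi>\<bar> + 2"] by auto
  moreover have "\<theta> (\<bar>\<xi>\<bar> + 2) \<le> \<theta> \<xi>" by (rule mono) simp
  ultimately show "0 \<le> \<theta> \<xi>" by simp
  show "\<theta> \<xi> \<le> 1" using mono[of 0 \<xi>] one[of 0] by simp
  show "\<theta> \<xi> \<noteq> 0 \<Longrightarrow> \<bar>\<xi>\<bar> < 2" by (rule z)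
  show "\<bar>\<xi>\<bar> \<le> 1 \<Longrightarrow> \<theta> \<xi> = 1" by (rule one)
  show "\<bar>\<xi>\<bar> \<le> \<bar>\<eta>\<bar> \<Longrightarrow> \<theta> \<eta> \<le> \<theta> \<xi>" by (rule mono)
qed

text \<open>Below \<open>A / 2\<close> both cutoffs in the difference equal 1 and cancel, which
  gives the lower bound; the lowest block is no difference and reaches down to 0.\<close>

lemma dyadic_cutoff_bounds:
  assumes "cutoff \<theta>" "1 \<le> A"
  shows "\<bar>dyadic_cutoff \<theta> A \<xi>\<bar> \<le> 1"
    and "dyadic_cutoff \<theta> A \<xi> \<noteq> 0 \<Longrightarrow> \<bar>\<xi>\<bar> < 2 * A"
    and "dyadic_cutoff \<theta> A \<xi> \<noteq> 0 \<Longrightarrow> A \<noteq> 1 \<Longrightarrow> A / 2 < \<bar>\<xi>\<bar>"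
proof -
  note c = cutoff_bounds[OF assms(1)]
  have mono: "\<theta> (2 * \<bar>\<xi>\<bar> / A) \<le> \<theta> (\<bar>\<xi>\<bar> / A)"
    using assms(2) by (intro c(5)) (simp add: divide_right_mono)
  show "\<bar>dyadic_cutoff \<theta> A \<xi>\<bar> \<le> 1"
    unfolding dyadic_cutoff_def
    using mono c(1)[of \<xi>] c(2)[of \<xi>] c(1)[of "2 * \<bar>\<xi>\<bar> / A"] c(2)[of "\<bar>\<xi>\<bar> / A"] by auto
  show "\<bar>\<xi>\<bar> < 2 * A" if nz: "dyadic_cutoff \<theta> A \<xi> \<noteq> 0"
  proof (cases "A = 1")
    case True
    then show ?thesis using nz c(3)[of \<xi>] by (simp add: dyadic_cutoff_def)
  next
    case False
    then have "\<theta> (\<bar>\<xi>\<bar> / A) \<noteq> 0"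
      using nz mono c(1)[of "2 * \<bar>\<xi>\<bar> / A"] by (auto simp: dyadic_cutoff_def)
    then have "\<bar>\<bar>\<xi>\<bar> / A\<bar> < 2" by (rule c(3))
    then show ?thesis using assms(2) by (simp add: field_simps)
  qed
  show "A / 2 < \<bar>\<xi>\<bar>" if nz: "dyadic_cutoff \<theta> A \<xi> \<noteq> 0" "A \<noteq> 1"
  proof (rule ccontr)
    assume "\<not> A / 2 < \<bar>\<xi>\<bar>"
    then have "\<bar>\<bar>\<xi>\<bar> / A\<bar> \<le> 1" "\<bar>2 * \<bar>\<xi>\<bar> / A\<bar> \<le> 1" using assms(2) by (auto simp: field_simps)
    then show False using nz c(4) by (auto simp: dyadic_cutoff_def)
  qed
qed

text \<open>The coefficients carry the constant weight 1; the height cutoff alone makes the lattice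
  sums finite, at a cost of order \<open>C\<close> per frozen coordinate. The three alternatives are
  the low block and the two signs of the frequency.\<close>

lemma airy_evolution_le:
  fixes \<omega> :: "real ^ 'n"
  assumes pos: "\<And>i. \<omega> $ i > 0" and nonres: "nonresonant \<omega>"
  obtains K where "0 < K" "\<And>T N C S c. 0 < T \<Longrightarrow> 1 \<le> N \<Longrightarrow> 1 \<le> C \<Longrightarrow> finite S \<Longrightarrow>
    (\<And>n. n \<in> S \<Longrightarrow> norm (lattice_vec n) \<le> 2 * C) \<Longrightarrow>
    (\<forall>n\<in>S. \<bar>freq \<omega> n\<bar> < 2) \<or> (\<forall>n\<in>S. N / 2 < freq \<omega> n) \<or> (\<forall>n\<in>S. freq \<omega> n < - (N / 2)) \<Longrightarrow>
    l4l4_norm T (evolution S c (freq \<omega>) (\<lambda>n. freq \<omega> n ^ 3))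
      \<le> K * T powr (1 / 4) * jbracket (T powr (- 1 / 2) * N powr (- 1 / 2)) powr (1 / 4)
         * C powr ((real CARD('n) - 1) / 4) * sqrt (\<Sum>n\<in>S. (cmod (c n))\<^sup>2)"
proof -
  define b where "b = CARD('n) - 1"
  have "1 \<le> CARD('n)" by (simp add: Suc_leI)
  then have b: "real b = real CARD('n) - 1" by (simp add: b_def)
  obtain j :: 'n where True by simp
  have w: "0 < \<omega> $ j" by (rule pos)
  define W where "W = 1 + 2 * pi / \<omega> $ j"
  have W: "1 \<le> W" using w by (simp add: W_def)
  \<comment> \<open>The 30 is dictated by the low block, 6 times the \<open>A = 5\<close> used
    there; the other blocks need only 6 and waste a factor 5.\<close>
  define K0 where "K0 = 30 * 5 ^ b * W"
  have K0: "0 < K0" using W by (simp add: K0_def)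
  show ?thesis
  proof
    show "0 < K0 powr (1 / 4)" using K0 by simp
    fix T N C :: real and S :: "(int ^ 'n) set" and c :: "int ^ 'n \<Rightarrow> complex"
    assume T: "0 < T" and N: "1 \<le> N" and C: "1 \<le> C" and S: "finite S"
      and ball: "\<And>n. n \<in> S \<Longrightarrow> norm (lattice_vec n) \<le> 2 * C"
      and cases: "(\<forall>n\<in>S. \<bar>freq \<omega> n\<bar> < 2) \<or> (\<forall>n\<in>S. N / 2 < freq \<omega> n) \<or> (\<forall>n\<in>S. freq \<omega> n < - (N / 2))"
    let ?Q = "\<Sum>n\<in>S. (cmod (c n))\<^sup>2"
    let ?F = "evolution S c (freq \<omega>) (\<lambda>n. freq \<omega> n ^ 3)"
    define B where "B = jbracket (T powr (- 1 / 2) * N powr (- 1 / 2))"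
    have B: "B = 1 + T powr (- 1 / 2) * N powr (- 1 / 2)" "1 \<le> B" by (auto simp: B_def jbracket_def)
    define g where "g k = (if \<bar>real_of_int k\<bar> \<le> 2 * C then 1 else 0 :: real)" for k
    have G: "(\<Sum>k\<in>K. g k) \<le> 5 * C" if "finite K" for K
    proof -
      let ?I = "{- \<lfloor>2 * C\<rfloor>..\<lfloor>2 * C\<rfloor>}"
      have "(\<Sum>k\<in>K. g k) = real (card {k\<in>K. \<bar>real_of_int k\<bar> \<le> 2 * C})"
        using that unfolding g_def by (simp add: sum.inter_filter[symmetric])
      also have "\<dots> \<le> real (card ?I)"
      proof -
        have "k \<in> ?I" if "\<bar>real_of_int k\<bar> \<le> 2 * C" for k
          using that by (auto simp: le_floor_iff minus_le_iff)
        then show ?thesis by (intro of_nat_mono card_mono) auto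
      qed
      \<comment> \<open>There are at most \<open>4 * C + 1\<close> integers, and the 1 is absorbed
        since \<open>C \<ge> 1\<close>.\<close>
      also have "\<dots> \<le> 5 * C"
      proof -
        have "0 \<le> \<lfloor>2 * C\<rfloor>" using C by simp
        then have "real (card ?I) = 2 * real_of_int \<lfloor>2 * C\<rfloor> + 1" by simp
        moreover have "real_of_int \<lfloor>2 * C\<rfloor> \<le> 2 * C" by simp
        ultimately show ?thesis using C by linarith
      qed
      finally show ?thesis .
    qed
    have vg: "1\<^sup>2 \<le> (\<Prod>i\<in>-{j}. g (n $ i))" if "n \<in> S" for n
    proof -
      have "\<bar>real_of_int (n $ i)\<bar> \<le> 2 * C" for i
        using ball[OF that] abs_component_le_norm_lattice_vec[of n i] by linarith
      then show ?thesis by (simp add: g_def)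
    qed
    have gC: "(5 * C) ^ (CARD('n) - 1) = 5 ^ b * C ^ b" by (simp add: b_def power_mult_distrib)
    have "l4l4_norm T ?F ^ 4 \<le> K0 * T * B * C ^ b * ?Q\<^sup>2"
    proof (cases "\<forall>n\<in>S. \<bar>freq \<omega> n\<bar> < 2")
      case True
      have "l4l4_norm T ?F ^ 4 \<le> 6 * 5 * T * (5 * C) ^ (CARD('n) - 1) * (1 + 2 * pi / (1 * \<omega> $ j)) * (\<Sum>n\<in>S. (cmod (c n))\<^sup>2 / 1)\<^sup>2"
        unfolding l4l4_norm_power4
      proof (rule LINT_lattice_evolution_le[OF S T inj_freq[OF nonres] _ vg _ G])
        fix m n assume "m \<in> S" "n \<in> S"
        have "1 / (1 + T * \<bar>freq \<omega> m ^ 3 + freq \<omega> n ^ 3 - (freq \<omega> k ^ 3 + freq \<omega> l ^ 3)\<bar>)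
            \<le> 5 * (1 / (1 + (1 * freq \<omega> k + 0)\<^sup>2) + 1 / (1 + (1 * freq \<omega> k + 0)\<^sup>2))" if k: "k \<in> S" for k l
        proof -
          \<comment> \<open>Oscillation is not exploited here: as
            \<open>\<bar>freq \<omega> k\<bar> < 2\<close>, the constant 1 is itself at most five
            times a Lorentzian centred at 0.\<close>
          have "(freq \<omega> k)\<^sup>2 \<le> 2\<^sup>2" using True k by (intro power2_le_iff_abs_le[THEN iffD2]) (auto simp: less_imp_le)
          then have "1 \<le> 5 * (1 / (1 + (freq \<omega> k)\<^sup>2))" by (simp add: pos_le_divide_eq add_pos_nonneg)
          moreover have "0 \<le> 1 / (1 + (freq \<omega> k)\<^sup>2)" by simp
          moreover have "1 / (1 + T * \<bar>freq \<omega> m ^ 3 + freq \<omega> n ^ 3 - (freq \<omega> k ^ 3 + freq \<omega> l ^ 3)\<bar>) \<le> 1"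
            using T by (simp add: divide_le_eq_1 add_pos_nonneg)
          ultimately show ?thesis by (simp only: mult_1 add_0_right distrib_left)
        qed
        then show "\<exists>a b. \<forall>k\<in>S. \<forall>l\<in>S. freq \<omega> k + freq \<omega> l = freq \<omega> m + freq \<omega> n \<longrightarrow>
          1 / (1 + T * \<bar>freq \<omega> m ^ 3 + freq \<omega> n ^ 3 - (freq \<omega> k ^ 3 + freq \<omega> l ^ 3)\<bar>)
            \<le> 5 * (1 / (1 + (1 * freq \<omega> k + a)\<^sup>2) + 1 / (1 + (1 * freq \<omega> k + b)\<^sup>2))" by blast
      qed (use w in \<open>auto simp: g_def\<close>)
      also have "\<dots> = K0 * T * 1 * C ^ b * ?Q\<^sup>2" unfolding gC by (simp add: K0_def W_def)
      also have "\<dots> \<le> K0 * T * B * C ^ b * ?Q\<^sup>2"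
        using K0 T C B(2) by (intro mult_right_mono mult_left_mono) auto
      finally show ?thesis .
    next
      case False
      then have sgn: "(\<forall>n\<in>S. N / 2 < freq \<omega> n) \<or> (\<forall>n\<in>S. freq \<omega> n < - (N / 2))" using cases by blast
      \<comment> \<open>On resonant quadruples the cubic phase difference is
        \<open>3 / 4 * ?M * ?d\<close>; equal signs prevent cancellation in the sum
        \<open>?M\<close>, so its modulus is at least \<open>N\<close>.\<close>
      let ?E = "3 / 4 * N"
      have "l4l4_norm T ?F ^ 4 \<le> 6 * T * (5 * C) ^ (CARD('n) - 1) * (1 + pi / (sqrt (T * ?E) * \<omega> $ j)) * (\<Sum>n\<in>S. (cmod (c n))\<^sup>2 / 1)\<^sup>2"
        unfolding l4l4_norm_power4
      proof (rule LINT_quadratic_phase_le[OF S T inj_freq[OF nonres] _ vg _ G w])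
        fix m n k l assume mn: "m \<in> S" "n \<in> S" and rel: "freq \<omega> k + freq \<omega> l = freq \<omega> m + freq \<omega> n"
        let ?M = "freq \<omega> m + freq \<omega> n" and ?d = "(freq \<omega> m - freq \<omega> n)\<^sup>2 - (freq \<omega> k - freq \<omega> l)\<^sup>2"
        have l: "freq \<omega> l = ?M - freq \<omega> k" using rel by simp
        have eq: "freq \<omega> m ^ 3 + freq \<omega> n ^ 3 - (freq \<omega> k ^ 3 + freq \<omega> l ^ 3) = 3 / 4 * ?M * ?d"
          unfolding l by (simp add: power2_eq_square power3_eq_cube field_simps)
        have "N \<le> \<bar>?M\<bar>" using sgn
        proof
          assume "\<forall>n\<in>S. N / 2 < freq \<omega> n"
          then have "N / 2 < freq \<omega> m" "N / 2 < freq \<omega> n" using mn by auto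
          then show ?thesis by linarith
        next
          assume "\<forall>n\<in>S. freq \<omega> n < - (N / 2)"
          then have "freq \<omega> m < - (N / 2)" "freq \<omega> n < - (N / 2)" using mn by auto
          then show ?thesis by linarith
        qed
        then have "?E * \<bar>?d\<bar> \<le> 3 / 4 * \<bar>?M\<bar> * \<bar>?d\<bar>" by (intro mult_right_mono mult_left_mono) auto
        then show "?E * \<bar>?d\<bar> \<le> \<bar>freq \<omega> m ^ 3 + freq \<omega> n ^ 3 - (freq \<omega> k ^ 3 + freq \<omega> l ^ 3)\<bar>"
          unfolding eq abs_mult by simp
      qed (use N in \<open>auto simp: g_def\<close>)
      also have "\<dots> \<le> K0 * T * B * C ^ b * ?Q\<^sup>2"
      proof -
        have TN: "0 < sqrt (T * N)" "0 < N * T" using T N by simp_all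
        have "sqrt (T * N) / 2 \<le> sqrt (T * ?E)"
          using T N by (intro real_le_rsqrt) (simp add: power_divide)
        then have "pi / (sqrt (T * ?E) * \<omega> $ j) \<le> pi / (sqrt (T * N) / 2 * \<omega> $ j)"
          using TN w by (intro divide_left_mono mult_right_mono mult_pos_pos) auto
        also have "\<dots> = (W - 1) * (1 / sqrt (T * N))" by (simp add: W_def mult.commute)
        also have "1 / sqrt (T * N) = T powr (- 1 / 2) * N powr (- 1 / 2)"
          using T N by (simp add: powr_minus powr_half_sqrt real_sqrt_mult inverse_eq_divide flip: minus_divide_left)
        also have "\<dots> = B - 1" using B(1) by simp
        finally have "1 + pi / (sqrt (T * ?E) * \<omega> $ j) \<le> 1 + (W - 1) * (B - 1)" by simp
        \<comment> \<open>Since \<open>W\<close> and \<open>B\<close> are at least 1, the difference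
          of the two sides is \<open>W + B - 2 \<ge> 0\<close>.\<close>
        also have "\<dots> \<le> W * B" using W B(2) by (simp add: algebra_simps)
        finally have "6 * T * (5 ^ b * C ^ b) * (1 + pi / (sqrt (T * ?E) * \<omega> $ j)) \<le> 6 * T * (5 ^ b * C ^ b) * (W * B)"
          using T C by (intro mult_left_mono) auto
        also have "\<dots> = 1 / 5 * (K0 * T * B * C ^ b)" by (simp add: K0_def)
        also have "\<dots> \<le> 1 * (K0 * T * B * C ^ b)" using K0 T B(2) C by (intro mult_right_mono) auto
        finally show ?thesis unfolding gC by (simp add: mult_right_mono)
      qed
      finally show ?thesis .
    qed
    then have "l4l4_norm T ?F \<le> (K0 * T * B * C ^ b) powr (1 / 4) * sqrt ?Q"
      using K0 T B(2) C by (intro le_powr_quarter) (auto intro!: sum_nonneg)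
    also have "(K0 * T * B * C ^ b) powr (1 / 4) = K0 powr (1 / 4) * T powr (1 / 4) * B powr (1 / 4) * C powr (real b / 4)"
      using K0 T B(2) C by (simp add: powr_mult powr_powr powr_realpow[symmetric])
    finally show "l4l4_norm T ?F \<le> K0 powr (1 / 4) * T powr (1 / 4) * jbracket (T powr (- 1 / 2) * N powr (- 1 / 2)) powr (1 / 4)
         * C powr ((real CARD('n) - 1) / 4) * sqrt ?Q" unfolding B_def b .
  qed
qed

text \<open>The projected function is a finite exponential sum whose coefficients are damped by
  factors of modulus at most 1, so Bessel's inequality bounds them by the mean-square norm of
  \<open>u\<close> itself.\<close>

lemma l4l4_airy_proj_le:
  fixes \<omega> :: "real ^ 'n"
  assumes pos: "\<And>i. \<omega> $ i > 0" and nonres: "nonresonant \<omega>" and cut: "cutoff \<theta>"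
  obtains K where "0 < K" "\<And>T N C u. 0 < T \<Longrightarrow> 1 \<le> N \<Longrightarrow> 1 \<le> C \<Longrightarrow> u \<in> besicovitch2 \<Longrightarrow>
    l4l4_norm T (\<lambda>t. airy t (freq_proj \<theta> \<omega> N (height_proj \<theta> \<omega> C u)))
      \<le> K * T powr (1 / 4) * jbracket (T powr (- 1 / 2) * N powr (- 1 / 2)) powr (1 / 4)
         * C powr ((real CARD('n) - 1) / 4) * besicovitch_norm 2 u"
proof -
  obtain K where K: "0 < K" and bound: "\<And>T N C S c. 0 < T \<Longrightarrow> 1 \<le> N \<Longrightarrow> 1 \<le> C \<Longrightarrow> finite S \<Longrightarrow>
    (\<And>n. n \<in> S \<Longrightarrow> norm (lattice_vec n) \<le> 2 * C) \<Longrightarrow>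
    (\<forall>n\<in>S. \<bar>freq \<omega> n\<bar> < 2) \<or> (\<forall>n\<in>S. N / 2 < freq \<omega> n) \<or> (\<forall>n\<in>S. freq \<omega> n < - (N / 2)) \<Longrightarrow>
    l4l4_norm T (evolution S c (freq \<omega>) (\<lambda>n. freq \<omega> n ^ 3))
      \<le> K * T powr (1 / 4) * jbracket (T powr (- 1 / 2) * N powr (- 1 / 2)) powr (1 / 4)
         * C powr ((real CARD('n) - 1) / 4) * sqrt (\<Sum>n\<in>S. (cmod (c n))\<^sup>2)"
    using airy_evolution_le[OF pos nonres] by blast
  have inj: "inj (freq \<omega>)" by (rule inj_freq[OF nonres])
  \<comment> \<open>The factor 2 pays for splitting into positive and negative frequencies by
    Minkowski's inequality.\<close>
  show ?thesis
  proof (rule that[of "2 * K"])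
    fix T N C :: real and u
    assume T: "0 < T" and N: "1 \<le> N" and C: "1 \<le> C" and u: "u \<in> besicovitch2"
    define a where "a n = bohr_coeff u (freq \<omega> n)" for n
    define m1 where "m1 n = dyadic_cutoff \<theta> C (norm (lattice_vec n))" for n :: "int ^ 'n"
    define m2 where "m2 n = dyadic_cutoff \<theta> N \<bar>freq \<omega> n\<bar>" for n
    define S1 where "S1 = {n. complex_of_real (m1 n) * a n \<noteq> 0}"
    define c where "c n = complex_of_real (m2 n) * (complex_of_real (m1 n) * a n)" for n
    define S where "S = {n. c n \<noteq> 0}"
    let ?h = "height_proj \<theta> \<omega> C u"
    have ball: "norm (lattice_vec n) \<le> 2 * C" if "n \<in> S1" for n
    proof -
      have "dyadic_cutoff \<theta> C (norm (lattice_vec n)) \<noteq> 0" using that by (auto simp: S1_def m1_def)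
      then show ?thesis using dyadic_cutoff_bounds(2)[OF cut C] by fastforce
    qed
    have fin1: "finite S1" by (rule finite_subset[OF _ finite_lattice_ball[of "2 * C"]]) (use ball in blast)
    have SS1: "S \<subseteq> S1" by (auto simp: S_def S1_def c_def)
    have fin: "finite S" using fin1 SS1 by (rule rev_finite_subset)
    have h: "?h = (\<lambda>x. \<Sum>n\<in>S1. complex_of_real (m1 n) * a n * exp (\<i> * complex_of_real (freq \<omega> n * x)))"
      unfolding height_proj_def lattice_multiplier_def S1_def m1_def a_def ..
    have bh: "bohr_coeff ?h (freq \<omega> n) = complex_of_real (m1 n) * a n" for n
      unfolding h bohr_coeff_exp_sum_at[OF fin1 inj] by (simp add: S1_def)
    have fh: "freq_proj \<theta> \<omega> N ?h = (\<lambda>x. \<Sum>n\<in>S. c n * exp (\<i> * complex_of_real (freq \<omega> n * x)))"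
      unfolding freq_proj_def lattice_multiplier_def bh S_def c_def m2_def ..
    have ev: "airy t (freq_proj \<theta> \<omega> N ?h) = evolution S c (freq \<omega>) (\<lambda>n. freq \<omega> n ^ 3) t" for t
      unfolding fh by (rule airy_exp_sum[OF fin inj])
    let ?B = "K * T powr (1 / 4) * jbracket (T powr (- 1 / 2) * N powr (- 1 / 2)) powr (1 / 4) * C powr ((real CARD('n) - 1) / 4)"
    have B0: "0 \<le> ?B" using K by simp
    have bessel: "sqrt (\<Sum>n\<in>R. (cmod (c n))\<^sup>2) \<le> besicovitch_norm 2 u" if "R \<subseteq> S" for R
    proof (rule real_le_lsqrt)
      have R: "finite R" using fin that by (rule rev_finite_subset)
      have "cmod (c n) \<le> cmod (a n)" for n
      proof -
        have "\<bar>m2 n\<bar> * (\<bar>m1 n\<bar> * cmod (a n)) \<le> 1 * (1 * cmod (a n))"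
          unfolding m1_def m2_def by (intro mult_mono dyadic_cutoff_bounds(1) cut C N) auto
        then show ?thesis by (simp add: c_def norm_mult)
      qed
      then have "(\<Sum>n\<in>R. (cmod (c n))\<^sup>2) \<le> (\<Sum>n\<in>R. (cmod (bohr_coeff u (freq \<omega> n)))\<^sup>2)"
        unfolding a_def by (intro sum_mono power_mono) auto
      also have "\<dots> = (\<Sum>\<xi>\<in>freq \<omega> ` R. (cmod (bohr_coeff u \<xi>))\<^sup>2)"
        using sum.reindex[OF inj_on_subset[OF inj subset_UNIV], of "\<lambda>\<xi>. (cmod (bohr_coeff u \<xi>))\<^sup>2" R] by (simp only: o_def)
      also have "\<dots> \<le> (besicovitch_norm 2 u)\<^sup>2" using R by (intro bessel_inequality u) simp
      finally show "(\<Sum>n\<in>R. (cmod (c n))\<^sup>2) \<le> (besicovitch_norm 2 u)\<^sup>2" .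
    qed (rule besicovitch_norm_nonneg)
    have part: "l4l4_norm T (evolution R c (freq \<omega>) (\<lambda>n. freq \<omega> n ^ 3)) \<le> ?B * besicovitch_norm 2 u"
      if R: "R \<subseteq> S" and cases: "(\<forall>n\<in>R. \<bar>freq \<omega> n\<bar> < 2) \<or> (\<forall>n\<in>R. N / 2 < freq \<omega> n) \<or> (\<forall>n\<in>R. freq \<omega> n < - (N / 2))" for R
    proof -
      have "l4l4_norm T (evolution R c (freq \<omega>) (\<lambda>n. freq \<omega> n ^ 3)) \<le> ?B * sqrt (\<Sum>n\<in>R. (cmod (c n))\<^sup>2)"
        using R SS1 ball by (intro bound T N C cases finite_subset[OF R fin]) blast
      also have "\<dots> \<le> ?B * besicovitch_norm 2 u" by (intro mult_left_mono bessel R B0)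
      finally show ?thesis .
    qed
    have nz: "dyadic_cutoff \<theta> N \<bar>freq \<omega> n\<bar> \<noteq> 0" if "n \<in> S" for n
      using that by (auto simp: S_def c_def m2_def)
    have "l4l4_norm T (evolution S c (freq \<omega>) (\<lambda>n. freq \<omega> n ^ 3)) \<le> 2 * (?B * besicovitch_norm 2 u)"
    proof (cases "N = 1")
      case True
      have "\<forall>n\<in>S. \<bar>freq \<omega> n\<bar> < 2" using dyadic_cutoff_bounds(2)[OF cut N nz] True by simp
      then have "l4l4_norm T (evolution S c (freq \<omega>) (\<lambda>n. freq \<omega> n ^ 3)) \<le> ?B * besicovitch_norm 2 u"
        by (intro part) auto
      moreover have "0 \<le> ?B * besicovitch_norm 2 u" by (intro mult_nonneg_nonneg B0 besicovitch_norm_nonneg)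
      ultimately show ?thesis by linarith
    next
      case False
      define P where "P = {n\<in>S. 0 < freq \<omega> n}"
      \<comment> \<open>Frequency 0 falls formally into this half, but is excluded by the lower
        bound \<open>N / 2\<close> on the modulus.\<close>
      define M where "M = {n\<in>S. \<not> 0 < freq \<omega> n}"
      have big: "N / 2 < \<bar>freq \<omega> n\<bar>" if "n \<in> S" for n
        using dyadic_cutoff_bounds(3)[OF cut N nz[OF that] False] by simp
      have "N / 2 < freq \<omega> n" if "n \<in> P" for n using big[of n] that by (auto simp: P_def)
      moreover have "freq \<omega> n < - (N / 2)" if "n \<in> M" for n using big[of n] that by (auto simp: M_def)
      moreover have "P \<subseteq> S" "M \<subseteq> S" by (auto simp: P_def M_def)
      ultimately have le: "l4l4_norm T (evolution P c (freq \<omega>) (\<lambda>n. freq \<omega> n ^ 3)) \<le> ?B * besicovitch_norm 2 u"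
        "l4l4_norm T (evolution M c (freq \<omega>) (\<lambda>n. freq \<omega> n ^ 3)) \<le> ?B * besicovitch_norm 2 u"
        by (intro part; blast)+
      have "l4l4_norm T (evolution S c (freq \<omega>) (\<lambda>n. freq \<omega> n ^ 3))
        \<le> l4l4_norm T (evolution P c (freq \<omega>) (\<lambda>n. freq \<omega> n ^ 3)) + l4l4_norm T (evolution M c (freq \<omega>) (\<lambda>n. freq \<omega> n ^ 3))"
      proof (rule l4l4_norm_add_le)
        have "S = P \<union> M" "P \<inter> M = {}" "finite P" "finite M" using fin by (auto simp: P_def M_def)
        then show "evolution S c (freq \<omega>) (\<lambda>n. freq \<omega> n ^ 3) t x
          = evolution P c (freq \<omega>) (\<lambda>n. freq \<omega> n ^ 3) t x + evolution M c (freq \<omega>) (\<lambda>n. freq \<omega> n ^ 3) t x" for t x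
          unfolding evolution_def by (simp add: sum.union_disjoint)
      qed (auto intro!: l4l4_integrable_evolution simp: P_def M_def fin)
      then show ?thesis using le by linarith
    qed
    then show "l4l4_norm T (\<lambda>t. airy t (freq_proj \<theta> \<omega> N (height_proj \<theta> \<omega> C u)))
      \<le> 2 * K * T powr (1 / 4) * jbracket (T powr (- 1 / 2) * N powr (- 1 / 2)) powr (1 / 4)
         * C powr ((real CARD('n) - 1) / 4) * besicovitch_norm 2 u"
      unfolding ev by (simp add: mult.assoc)
  qed (use K in simp)
qed

section \<open>Convergence of partial sums\<close>

text \<open>A difference of partial sums is again an evolution, with coefficients supported on a
  symmetric difference, so the a priori bound and the tails of the weighted series make the net
  Cauchy. Minkowski's inequality transfers this to the norms.\<close>

lemma evolution_partial_sums_converge: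
  fixes \<omega> :: "real ^ 'n" and a :: "int ^ 'n \<Rightarrow> complex" and w :: "int ^ 'n \<Rightarrow> real"
  assumes nonneg: "\<And>n. 0 \<le> w n" and B: "0 \<le> B"
    and summ: "(\<lambda>n. w n * (cmod (a n))\<^sup>2) summable_on UNIV"
    and bound: "\<And>S c. finite S \<Longrightarrow>
       l4l4_norm T (evolution S c (freq \<omega>) \<phi>) \<le> B * sqrt (\<Sum>n\<in>S. w n * (cmod (c n))\<^sup>2)"
  shows "((\<lambda>(S, S'). l4l4_norm T (\<lambda>t x. evolution S a (freq \<omega>) \<phi> t x - evolution S' a (freq \<omega>) \<phi> t x)) \<longlongrightarrow> 0)
      (finite_subsets_at_top UNIV \<times>\<^sub>F finite_subsets_at_top UNIV)" (is ?th1)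
    and "\<exists>l \<le> B * sqrt (\<Sum>\<^sub>\<infinity>n. w n * (cmod (a n))\<^sup>2).
      ((\<lambda>S. l4l4_norm T (evolution S a (freq \<omega>) \<phi>)) \<longlongrightarrow> l) (finite_subsets_at_top UNIV)" (is ?th2)
proof -
  let ?f = "\<lambda>n. w n * (cmod (a n))\<^sup>2"
  let ?U = "\<lambda>S. evolution S a (freq \<omega>) \<phi>"
  let ?D = "\<lambda>S S' t x. ?U S t x - ?U S' t x"
  define d where "d S S' n = (if n \<in> S then a n else 0) - (if n \<in> S' then a n else 0)" for S S' n
  have D: "?D S S' = evolution (S \<union> S') (d S S') (freq \<omega>) \<phi>" if "finite S" "finite S'" for S S'
  proof (intro ext)
    fix t x
    let ?e = "\<lambda>n. exp (\<i> * complex_of_real (freq \<omega> n * x - t * \<phi> n))"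
    have ext: "(\<Sum>n\<in>R. a n * ?e n) = (\<Sum>n\<in>S \<union> S'. (if n \<in> R then a n else 0) * ?e n)" if "R \<subseteq> S \<union> S'" for R
      using that \<open>finite S\<close> \<open>finite S'\<close> by (intro sum.mono_neutral_cong_left) auto
    show "?D S S' t x = evolution (S \<union> S') (d S S') (freq \<omega>) \<phi> t x"
      unfolding evolution_def d_def left_diff_distrib sum_subtractf
      by (intro arg_cong2[of _ _ _ _ "(-)"] ext) auto
  qed
  have small: "\<exists>F. finite F \<and> (\<forall>S S'. finite S \<and> finite S' \<and> F \<subseteq> S \<and> F \<subseteq> S' \<longrightarrow> l4l4_norm T (?D S S') < e)"
    if e: "0 < e" for e
  proof -
    \<comment> \<open>Chosen so that \<open>B * sqrt \<delta> < e\<close>; \<open>B + 1\<close>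
      avoids a division by zero.\<close>
    define \<delta> where "\<delta> = (e / (B + 1))\<^sup>2"
    have "0 < \<delta>" using e B by (simp add: \<delta>_def)
    then obtain F where F: "finite F" and tail: "\<And>X. finite X \<Longrightarrow> X \<inter> F = {} \<Longrightarrow> (\<Sum>n\<in>X. ?f n) < \<delta>"
      using summable_on_finite_tail[OF summ] by blast
    have "l4l4_norm T (?D S S') < e" if S: "finite S" "finite S'" "F \<subseteq> S" "F \<subseteq> S'" for S S'
    proof -
      let ?X = "(S \<union> S') - (S \<inter> S')"
      have "(\<Sum>n\<in>S \<union> S'. w n * (cmod (d S S' n))\<^sup>2) = (\<Sum>n\<in>?X. ?f n)"
        using S by (intro sum.mono_neutral_cong_right) (auto simp: d_def)
      also have "\<dots> < \<delta>" using S by (intro tail) auto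
      finally have "sqrt (\<Sum>n\<in>S \<union> S'. w n * (cmod (d S S' n))\<^sup>2) < e / (B + 1)"
        using e B by (intro real_less_lsqrt) (auto simp: \<delta>_def intro!: sum_nonneg nonneg)
      then have "B * sqrt (\<Sum>n\<in>S \<union> S'. w n * (cmod (d S S' n))\<^sup>2) \<le> B * (e / (B + 1))"
        using B by (intro mult_left_mono) auto
      also have "\<dots> < e" using e B by (simp add: field_simps)
      finally show ?thesis unfolding D[OF S(1,2)] using bound[of "S \<union> S'" "d S S'"] S by auto
    qed
    then show ?thesis using F by blast
  qed
  show ?th1
  proof (rule tendstoI)
    fix e :: real assume "0 < e"
    then obtain F where F: "finite F" and lt: "\<And>S S'. finite S \<Longrightarrow> finite S' \<Longrightarrow> F \<subseteq> S \<Longrightarrow> F \<subseteq> S' \<Longrightarrow> l4l4_norm T (?D S S') < e"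
      using small by meson
    have ev: "\<forall>\<^sub>F S in finite_subsets_at_top UNIV. finite S \<and> F \<subseteq> S"
      unfolding eventually_finite_subsets_at_top using F by blast
    show "\<forall>\<^sub>F p in finite_subsets_at_top UNIV \<times>\<^sub>F finite_subsets_at_top UNIV.
        dist (case p of (S, S') \<Rightarrow> l4l4_norm T (?D S S')) 0 < e"
      unfolding eventually_prod_filter
      by (intro exI[of _ "\<lambda>S. finite S \<and> F \<subseteq> S"] conjI ev) (auto simp: l4l4_norm_nonneg intro: lt)
  qed
  have tri: "l4l4_norm T (?U S) \<le> l4l4_norm T (?U S') + l4l4_norm T (?D S S')" if "finite S" "finite S'" for S S'
  proof (rule l4l4_norm_add_le)
    show "l4l4_integrable T (?D S S')" unfolding D[OF that] using that by (intro l4l4_integrable_evolution) simp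
  qed (use that in \<open>auto intro: l4l4_integrable_evolution\<close>)
  have "\<exists>l. ((\<lambda>S. l4l4_norm T (?U S)) \<longlongrightarrow> l) (finite_subsets_at_top UNIV)"
  proof (rule Cauchy_net_convergent)
    fix e :: real assume "0 < e"
    then obtain F where F: "finite F" and lt: "\<And>S S'. finite S \<Longrightarrow> finite S' \<Longrightarrow> F \<subseteq> S \<Longrightarrow> F \<subseteq> S' \<Longrightarrow> l4l4_norm T (?D S S') < e"
      using small by meson
    have "dist (l4l4_norm T (?U S)) (l4l4_norm T (?U S')) < e"
      if "finite S \<and> F \<subseteq> S" "finite S' \<and> F \<subseteq> S'" for S S'
      using that tri[of S S'] tri[of S' S] lt[of S S'] lt[of S' S] unfolding dist_real_def by linarith
    moreover have "\<forall>\<^sub>F S in finite_subsets_at_top UNIV. finite S \<and> F \<subseteq> S"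
      unfolding eventually_finite_subsets_at_top using F by blast
    ultimately show "\<exists>P. eventually P (finite_subsets_at_top UNIV) \<and>
        (\<forall>S S'. P S \<and> P S' \<longrightarrow> dist (l4l4_norm T (?U S)) (l4l4_norm T (?U S')) < e)" by blast
  qed simp
  then obtain l where l: "((\<lambda>S. l4l4_norm T (?U S)) \<longlongrightarrow> l) (finite_subsets_at_top UNIV)" by blast
  have "l \<le> B * sqrt (\<Sum>\<^sub>\<infinity>n. ?f n)"
  proof (rule tendsto_upperbound[OF l])
    have "l4l4_norm T (?U S) \<le> B * sqrt (\<Sum>\<^sub>\<infinity>n. ?f n)" if "finite S" for S
    proof -
      have "(\<Sum>n\<in>S. ?f n) \<le> (\<Sum>\<^sub>\<infinity>n. ?f n)"
        using that by (intro finite_sum_le_infsum summ) (auto intro: mult_nonneg_nonneg nonneg)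
      then have "B * sqrt (\<Sum>n\<in>S. ?f n) \<le> B * sqrt (\<Sum>\<^sub>\<infinity>n. ?f n)" using B by (intro mult_left_mono) auto
      then show ?thesis using bound[OF that, of a] by linarith
    qed
    then show "\<forall>\<^sub>F S in finite_subsets_at_top UNIV. l4l4_norm T (?U S) \<le> B * sqrt (\<Sum>\<^sub>\<infinity>n. ?f n)"
      unfolding eventually_finite_subsets_at_top by blast
  qed simp
  then show ?th2 using l by blast
qed

text \<open>In the quadratic case the bound for finite sums is extended along the net of finite
  partial sums. In the cubic case the height cutoff already leaves a finite sum, and the bound
  applies to all of \<open>besicovitch2\<close> without a limit.\<close>

theorem theorem1p1:
  fixes \<omega> :: "real ^ 'n" and \<theta> :: "real \<Rightarrow> real" and b :: real
  assumes pos: "\<And>i. \<omega> $ i > 0"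
    and nonres: "nonresonant \<omega>"
    and cut: "cutoff \<theta>"
    and b: "b = real CARD('n) - 1"
  shows
    "(\<forall>s > b / 4. \<exists>K > 0. \<forall>T. 0 < T \<and> T \<le> 1 \<longrightarrow>
        (\<forall>u. trig_poly u \<and> spectrum u \<subseteq> freq_module \<omega> \<longrightarrow>
           l4l4_norm T (\<lambda>t. schroedinger t u) \<le> K * T powr (1 / 8) * sobolev_norm \<omega> s u)
      \<and> (\<forall>u \<in> besicovitch2. spectrum u \<subseteq> freq_module \<omega> \<and> sobolev_term \<omega> s u summable_on UNIV \<longrightarrow>
           ((\<lambda>(S, S'). l4l4_norm T (\<lambda>t x. schroedinger t (fourier_partial \<omega> S u) x
                                       - schroedinger t (fourier_partial \<omega> S' u) x)) \<longlongrightarrow> 0)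
             (finite_subsets_at_top UNIV \<times>\<^sub>F finite_subsets_at_top UNIV)
         \<and> (\<exists>l \<le> K * T powr (1 / 8) * sobolev_norm \<omega> s u.
              ((\<lambda>S. l4l4_norm T (\<lambda>t. schroedinger t (fourier_partial \<omega> S u))) \<longlongrightarrow> l)
                (finite_subsets_at_top UNIV))))
   \<and> (\<forall>\<kappa> > 0. \<exists>K > 0. \<forall>T. 0 < T \<and> T \<le> 1 \<longrightarrow>
        (\<forall>N \<in> dyadic. \<forall>C \<in> dyadic. 1 \<le> N \<and> N \<le> \<kappa> * C \<longrightarrow>
          (\<forall>u \<in> besicovitch2. spectrum u \<subseteq> freq_module \<omega> \<longrightarrow>
             l4l4_norm T (\<lambda>t. airy t (freq_proj \<theta> \<omega> N (height_proj \<theta> \<omega> C u)))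
               \<le> K * T powr (1 / 4)
                   * jbracket (T powr (- 1 / 2) * N powr (- 1 / 2)) powr (1 / 4)
                   * C powr (b / 4) * besicovitch_norm 2 u)))"
proof (intro conjI allI impI)
  have inj: "inj (freq \<omega>)" by (rule inj_freq[OF nonres])
  fix s :: real assume "b / 4 < s"
  then have s: "(real CARD('n) - 1) / 4 < s" unfolding b .
  obtain K where K: "0 < K" and bound: "\<And>T S c. 0 < T \<Longrightarrow> T \<le> 1 \<Longrightarrow> finite S \<Longrightarrow>
    l4l4_norm T (evolution S c (freq \<omega>) (\<lambda>n. (freq \<omega> n)\<^sup>2))
      \<le> K * T powr (1 / 8) * sqrt (\<Sum>n\<in>S. jbracket (lattice_vec n) powr (2 * s) * (cmod (c n))\<^sup>2)"
    using schroedinger_evolution_le[OF pos nonres s] by blast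
  have tp: "l4l4_norm T (\<lambda>t. schroedinger t u) \<le> K * T powr (1 / 8) * sobolev_norm \<omega> s u"
    if T: "0 < T" "T \<le> 1" and tp: "trig_poly u" "spectrum u \<subseteq> freq_module \<omega>" for T u
  proof -
    obtain X c where X: "finite X" and u: "u = (\<lambda>x. \<Sum>n\<in>X. c n * exp (\<i> * complex_of_real (freq \<omega> n * x)))"
      using trig_poly_lattice_sum[OF tp inj] by blast
    show ?thesis
      unfolding u sobolev_norm_exp_sum[OF X inj] schroedinger_exp_sum[OF X inj]
      by (rule bound[OF T X])
  qed
  have partial: "schroedinger t (fourier_partial \<omega> S u)
      = evolution S (\<lambda>n. bohr_coeff u (freq \<omega> n)) (freq \<omega>) (\<lambda>n. (freq \<omega> n)\<^sup>2) t"
    if "finite S" for S u t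
    unfolding fourier_partial_def by (rule schroedinger_exp_sum[OF that inj])
  have lim: "((\<lambda>(S, S'). l4l4_norm T (\<lambda>t x. schroedinger t (fourier_partial \<omega> S u) x
                 - schroedinger t (fourier_partial \<omega> S' u) x)) \<longlongrightarrow> 0)
             (finite_subsets_at_top UNIV \<times>\<^sub>F finite_subsets_at_top UNIV)
         \<and> (\<exists>l \<le> K * T powr (1 / 8) * sobolev_norm \<omega> s u.
              ((\<lambda>S. l4l4_norm T (\<lambda>t. schroedinger t (fourier_partial \<omega> S u))) \<longlongrightarrow> l)
                (finite_subsets_at_top UNIV))"
    if T: "0 < T" "T \<le> 1" and summ: "sobolev_term \<omega> s u summable_on UNIV" for T u
  proof -
    let ?a = "\<lambda>n. bohr_coeff u (freq \<omega> n)" and ?w = "\<lambda>n. jbracket (lattice_vec n) powr (2 * s)"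
    let ?U = "\<lambda>S. evolution S ?a (freq \<omega>) (\<lambda>n. (freq \<omega> n)\<^sup>2)"
    have B: "0 \<le> K * T powr (1 / 8)" using K by simp
    have term_eq: "sobolev_term \<omega> s u = (\<lambda>n. ?w n * (cmod (?a n))\<^sup>2)" unfolding sobolev_term_def ..
    note conv = evolution_partial_sums_converge[OF _ B summ[unfolded term_eq] bound[OF T]]
    \<comment> \<open>Propagated partial sums are identified with evolutions for finite index sets,
      so the limits are transferred by equality eventually along the filter.\<close>
    have fin: "\<forall>\<^sub>F S :: (int ^ 'n) set in finite_subsets_at_top UNIV. finite S"
      by (rule eventually_finite_subsets_at_top_weakI)
    have "((\<lambda>(S, S'). l4l4_norm T (\<lambda>t x. ?U S t x - ?U S' t x)) \<longlongrightarrow> 0)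
        (finite_subsets_at_top UNIV \<times>\<^sub>F finite_subsets_at_top UNIV)"
      by (rule conv(1)) simp
    then have 1: "((\<lambda>(S, S'). l4l4_norm T (\<lambda>t x. schroedinger t (fourier_partial \<omega> S u) x
                 - schroedinger t (fourier_partial \<omega> S' u) x)) \<longlongrightarrow> 0)
             (finite_subsets_at_top UNIV \<times>\<^sub>F finite_subsets_at_top UNIV)"
    proof (rule Lim_transform_eventually)
      show "\<forall>\<^sub>F p in finite_subsets_at_top UNIV \<times>\<^sub>F finite_subsets_at_top UNIV.
        (case p of (S, S') \<Rightarrow> l4l4_norm T (\<lambda>t x. ?U S t x - ?U S' t x))
        = (case p of (S, S') \<Rightarrow> l4l4_norm T (\<lambda>t x. schroedinger t (fourier_partial \<omega> S u) x
                 - schroedinger t (fourier_partial \<omega> S' u) x))"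
        unfolding eventually_prod_filter
        by (intro exI[of _ finite] conjI fin) (auto simp: partial)
    qed
    obtain l where le: "l \<le> K * T powr (1 / 8) * sqrt (\<Sum>\<^sub>\<infinity>n. ?w n * (cmod (?a n))\<^sup>2)"
      and "((\<lambda>S. l4l4_norm T (?U S)) \<longlongrightarrow> l) (finite_subsets_at_top UNIV)"
      using conv(2) by auto
    from this(2) have "((\<lambda>S. l4l4_norm T (\<lambda>t. schroedinger t (fourier_partial \<omega> S u))) \<longlongrightarrow> l) (finite_subsets_at_top UNIV)"
      by (rule Lim_transform_eventually) (use fin in eventually_elim, simp add: partial)
    with 1 le show ?thesis unfolding sobolev_norm_def term_eq by blast
  qed
  show "\<exists>K > 0. \<forall>T. 0 < T \<and> T \<le> 1 \<longrightarrow>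
        (\<forall>u. trig_poly u \<and> spectrum u \<subseteq> freq_module \<omega> \<longrightarrow>
           l4l4_norm T (\<lambda>t. schroedinger t u) \<le> K * T powr (1 / 8) * sobolev_norm \<omega> s u)
      \<and> (\<forall>u \<in> besicovitch2. spectrum u \<subseteq> freq_module \<omega> \<and> sobolev_term \<omega> s u summable_on UNIV \<longrightarrow>
           ((\<lambda>(S, S'). l4l4_norm T (\<lambda>t x. schroedinger t (fourier_partial \<omega> S u) x
                                       - schroedinger t (fourier_partial \<omega> S' u) x)) \<longlongrightarrow> 0)
             (finite_subsets_at_top UNIV \<times>\<^sub>F finite_subsets_at_top UNIV)
         \<and> (\<exists>l \<le> K * T powr (1 / 8) * sobolev_norm \<omega> s u.
              ((\<lambda>S. l4l4_norm T (\<lambda>t. schroedinger t (fourier_partial \<omega> S u))) \<longlongrightarrow> l)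
                (finite_subsets_at_top UNIV)))"
    by (rule exI[of _ K], intro conjI K allI impI ballI)
      (elim conjE, rule tp lim[THEN conjunct1] lim[THEN conjunct2], assumption+)+
next
  fix \<kappa> :: real
  obtain K where K: "0 < K" and bound: "\<And>T N C u. 0 < T \<Longrightarrow> 1 \<le> N \<Longrightarrow> 1 \<le> C \<Longrightarrow> u \<in> besicovitch2 \<Longrightarrow>
    l4l4_norm T (\<lambda>t. airy t (freq_proj \<theta> \<omega> N (height_proj \<theta> \<omega> C u)))
      \<le> K * T powr (1 / 4) * jbracket (T powr (- 1 / 2) * N powr (- 1 / 2)) powr (1 / 4)
         * C powr ((real CARD('n) - 1) / 4) * besicovitch_norm 2 u"
    using l4l4_airy_proj_le[OF pos nonres cut] by blast
  have "1 \<le> C" if "C \<in> dyadic" for C using that by (auto simp: dyadic_def)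
  then show "\<exists>K > 0. \<forall>T. 0 < T \<and> T \<le> 1 \<longrightarrow>
        (\<forall>N \<in> dyadic. \<forall>C \<in> dyadic. 1 \<le> N \<and> N \<le> \<kappa> * C \<longrightarrow>
          (\<forall>u \<in> besicovitch2. spectrum u \<subseteq> freq_module \<omega> \<longrightarrow>
             l4l4_norm T (\<lambda>t. airy t (freq_proj \<theta> \<omega> N (height_proj \<theta> \<omega> C u)))
               \<le> K * T powr (1 / 4)
                   * jbracket (T powr (- 1 / 2) * N powr (- 1 / 2)) powr (1 / 4)
                   * C powr (b / 4) * besicovitch_norm 2 u))"
    using K bound unfolding b by blast
qed

end
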